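(* Let $B$ be a unital prime $C^*$-algebra and let $a,b\in B$ and $M>0$ be such that $\|[b,x]\|\leq M\|[a,x]\|$ for all selfadjoint $x\in B$. If $a$ is normal, then $b=f(a)$ for some function $f:\sigma(a)\to\mathbb{C}$ that is Lipschitz with Lipschitz constant $M$, i.e. $|f(s)-f(t)|\le M|s-t|$ for all $s,t\in\sigma(a)$.
   Context: All algebras have an identity element. $[u,v]=uv-vu$; $\sigma(a)$ is the spectrum of $a$; $f(a)$ is defined by the continuous functional calculus of the normal element $a$. A $C^*$-algebra $B$ is prime if for $u,v\in B$, $uBv=0$ implies $u=0$ or $v=0$. *)

theory Defs
  imports "HOL-Analysis.Analysis"
begin

(* The superclass real_normed_algebra_1 carries 1 ~= 0 and norm 1 = 1, so the
   zero algebra is excluded; scaleC extends the real scalar multiplication. *)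
class unital_cstar_algebra = real_normed_algebra_1 + banach +
  fixes scaleC :: "complex \<Rightarrow> 'a \<Rightarrow> 'a"  (infixr "*\<^sub>C" 75)
    and adj :: "'a \<Rightarrow> 'a"
  assumes scaleR_scaleC: "r *\<^sub>R x = complex_of_real r *\<^sub>C x"
    and scaleC_add_right: "c *\<^sub>C (x + y) = c *\<^sub>C x + c *\<^sub>C y"
    and scaleC_add_left: "(c + d) *\<^sub>C x = c *\<^sub>C x + d *\<^sub>C x"
    and scaleC_scaleC: "c *\<^sub>C (d *\<^sub>C x) = (c * d) *\<^sub>C x"
    and mult_scaleC_left: "(c *\<^sub>C x) * y = c *\<^sub>C (x * y)"
    and mult_scaleC_right: "x * (c *\<^sub>C y) = c *\<^sub>C (x * y)"
    and norm_scaleC: "norm (c *\<^sub>C x) = cmod c * norm x"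
    and adj_adj: "adj (adj x) = x"
    and adj_add: "adj (x + y) = adj x + adj y"
    and adj_scaleC: "adj (c *\<^sub>C x) = cnj c *\<^sub>C adj x"
    and adj_mult: "adj (x * y) = adj y * adj x"
    and cstar_identity: "norm (adj x * x) = (norm x)\<^sup>2"

class prime_cstar_algebra = unital_cstar_algebra +
  assumes prime_cstar: "(\<forall>x. u * x * v = 0) \<Longrightarrow> u = 0 \<or> v = 0"

definition selfadjoint :: "'a::unital_cstar_algebra \<Rightarrow> bool"
  where "selfadjoint x \<longleftrightarrow> adj x = x"

definition normal_element :: "'a::unital_cstar_algebra \<Rightarrow> bool"
  where "normal_element a \<longleftrightarrow> adj a * a = a * adj a"

definition commutator :: "'a::unital_cstar_algebra \<Rightarrow> 'a \<Rightarrow> 'a"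
  where "commutator u v = u * v - v * u"

definition spectrum :: "'a::unital_cstar_algebra \<Rightarrow> complex set"
  where "spectrum a =
    {z. \<not> (\<exists>y. (a - z *\<^sub>C 1) * y = 1 \<and> y * (a - z *\<^sub>C 1) = 1)}"

(* Phi is the isometric unital *-homomorphism from C(spectrum a) that sends the
   identity function to a.  An element of C(spectrum a) is represented by any
   total function whose restriction to the spectrum it is; the last two clauses
   make Phi independent of the values off the spectrum and fix a dummy value at
   functions that are not continuous there, so that Phi is unique. *)
definition is_cont_fun_calculus ::
    "'a::unital_cstar_algebra \<Rightarrow> ((complex \<Rightarrow> complex) \<Rightarrow> 'a) \<Rightarrow> bool"
  where "is_cont_fun_calculus a \<Phi> \<longleftrightarrow>
    \<Phi> (\<lambda>z. 1) = 1 \<and>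
    \<Phi> (\<lambda>z. z) = a \<and>
    (\<forall>f g. continuous_on (spectrum a) f \<longrightarrow> continuous_on (spectrum a) g \<longrightarrow>
        \<Phi> (\<lambda>z. f z + g z) = \<Phi> f + \<Phi> g \<and>
        \<Phi> (\<lambda>z. f z * g z) = \<Phi> f * \<Phi> g) \<and>
    (\<forall>c f. continuous_on (spectrum a) f \<longrightarrow>
        \<Phi> (\<lambda>z. c * f z) = c *\<^sub>C \<Phi> f \<and>
        \<Phi> (\<lambda>z. cnj (f z)) = adj (\<Phi> f) \<and>
        norm (\<Phi> f) = (SUP z\<in>spectrum a. cmod (f z))) \<and>
    (\<forall>f g. continuous_on (spectrum a) f \<longrightarrow>
        (\<forall>z\<in>spectrum a. f z = g z) \<longrightarrow> \<Phi> f = \<Phi> g) \<and>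
    (\<forall>f. \<not> continuous_on (spectrum a) f \<longrightarrow> \<Phi> f = 0)"

(* Meaningful for normal a only: for these Phi exists and is unique. *)
definition cont_fun_calculus ::
    "'a::unital_cstar_algebra \<Rightarrow> (complex \<Rightarrow> complex) \<Rightarrow> 'a"
  where "cont_fun_calculus a = (THE \<Phi>. is_cont_fun_calculus a \<Phi>)"

end

theory Submission
  imports Defs "HOL-Computational_Algebra.Fundamental_Theorem_Algebra"
begin

text \<open>Selfadjoint elements commuting with \<open>a\<close> commute with \<open>b\<close>; hence \<open>b\<close> is normal and commutes with
  \<open>a\<close> and \<open>a\<^sup>*\<close>. Let \<open>(s, p)\<close> and \<open>(t, q)\<close> be joint approximate eigenvalues of \<open>(a, b)\<close>, localised by
  elements \<open>e\<close> and \<open>g\<close> of the commutative algebra generated by \<open>a\<close> and \<open>b\<close>. Since the algebra is prime,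
  there is \<open>z = e y g\<^sup>* \<noteq> 0\<close>, and for \<open>x = z + z\<^sup>*\<close> one has \<open>[a, x] \<approx> (s - t)(z - z\<^sup>*)\<close> and
  \<open>[b, x] \<approx> (p - q)(z - z\<^sup>*)\<close>, so that \<open>\<bar>p - q\<bar> \<le> M \<bar>s - t\<bar>\<close>. The joint spectrum of \<open>(a, b)\<close> is therefore
  the graph of a Lipschitz function \<open>f\<close>, and \<open>b = f(a)\<close>.

  Gelfand duality is not needed: the spectral radius formula for selfadjoint elements gives a
  contractive calculus on an interval, whose hat functions yield the localising elements and, through
  them, all norm identities in several commuting variables.\<close>

text \<open>The hypothesis controls only selfadjoint \<open>x\<close>, so the off-diagonal element
  \<open>z\<close> itself cannot be inserted. Symmetrising it produces \<open>z - adj z\<close>,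
  which might be far shorter than \<open>z\<close>. A small square of \<open>z\<close> excludes
  this, and since the same element \<open>z - adj z\<close> appears for both commutators, its norm
  cancels and the constant stays exactly \<open>M\<close>. Estimates are needed for multiplication
  by \<open>a\<close> from both sides, and one from the right is the adjoint of one from the left
  for \<open>adj a\<close>; hence \<open>a\<close> and \<open>adj a\<close> are treated together
  throughout. A C*-algebra may contain no nontrivial projections, so localisation is by bump
  functions, with errors that tend to 0 at the end. The inequality over one and the same
  \<open>s\<close> leaves room for at most one \<open>p\<close>, which makes \<open>f\<close> a
  function. For \<open>d = b - f(a)\<close>, the norm of \<open>adj d * d\<close> is attained at a
  joint approximate eigenvalue \<open>(s, p)\<close>, where \<open>p = f s\<close> makes it
  vanish.\<close>

lemma scaleC_one [simp]: "1 *\<^sub>C (x::'a::unital_cstar_algebra) = x"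
  using scaleR_scaleC[of 1 x] by simp

lemma scaleC_zero_left [simp]: "0 *\<^sub>C (x::'a::unital_cstar_algebra) = 0"
  using scaleC_add_left[of 0 0 x] by simp

lemma scaleC_zero_right [simp]: "c *\<^sub>C 0 = (0::'a::unital_cstar_algebra)"
  using scaleC_add_right[of c 0 0] by simp

lemma scaleC_minus_left: "(- c) *\<^sub>C (x::'a::unital_cstar_algebra) = - (c *\<^sub>C x)"
proof -
  have "(- c) *\<^sub>C x + c *\<^sub>C x = 0"
    by (simp flip: scaleC_add_left)
  then show ?thesis by (simp add: eq_neg_iff_add_eq_0)
qed

lemma scaleC_minus_right: "c *\<^sub>C (- x) = - (c *\<^sub>C (x::'a::unital_cstar_algebra))"
proof -
  have "c *\<^sub>C (- x) + c *\<^sub>C x = 0"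
    by (simp flip: scaleC_add_right)
  then show ?thesis by (simp add: eq_neg_iff_add_eq_0)
qed

lemma scaleC_diff_right: "c *\<^sub>C ((x::'a::unital_cstar_algebra) - y) = c *\<^sub>C x - c *\<^sub>C y"
  using scaleC_add_right[of c x "- y"] by (simp add: scaleC_minus_right)

lemma scaleC_diff_left: "(c - d) *\<^sub>C (x::'a::unital_cstar_algebra) = c *\<^sub>C x - d *\<^sub>C x"
  using scaleC_add_left[of c "- d" x] by (simp add: scaleC_minus_left)

lemma adj_zero [simp]: "adj 0 = (0::'a::unital_cstar_algebra)"
  using adj_add[of 0 0] by simp

lemma adj_minus: "adj (- (x::'a::unital_cstar_algebra)) = - adj x"
proof -
  have "adj (- x) + adj x = 0"
    by (simp flip: adj_add)
  then show ?thesis by (simp add: eq_neg_iff_add_eq_0)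
qed

lemma adj_diff: "adj ((x::'a::unital_cstar_algebra) - y) = adj x - adj y"
  using adj_add[of x "- y"] by (simp add: adj_minus)

lemma adj_one [simp]: "adj 1 = (1::'a::unital_cstar_algebra)"
proof -
  have "1 = adj (adj 1 * (1::'a))" by (simp add: adj_adj)
  also have "\<dots> = adj (1::'a)" unfolding adj_mult adj_adj by simp
  finally show ?thesis ..
qed

lemma norm_adj [simp]: "norm (adj (x::'a::unital_cstar_algebra)) = norm x"
proof -
  have le: "norm y \<le> norm (adj y)" for y :: 'a
  proof (cases "norm y = 0")
    case False
    have "norm y * norm y \<le> norm (adj y) * norm y"
      using norm_mult_ineq[of "adj y" y] cstar_identity[of y] by (simp add: power2_eq_square)
    then show ?thesis using False by (simp add: less_le)
  qed simp
  from le[of x] le[of "adj x"] show ?thesis by (simp add: adj_adj)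
qed

lemmas scaleC_ring_simps = scaleC_add_left scaleC_add_right scaleC_diff_left scaleC_diff_right
  scaleC_minus_left scaleC_minus_right scaleC_scaleC mult_scaleC_left mult_scaleC_right

lemmas adj_simps = adj_adj adj_add adj_diff adj_minus adj_scaleC adj_mult

lemma bounded_linear_adj: "bounded_linear (adj :: 'a::unital_cstar_algebra \<Rightarrow> 'a)"
  by (rule bounded_linear_intro[where K = 1]) (simp_all add: adj_add scaleR_scaleC adj_scaleC)

lemma bounded_bilinear_scaleC:
  "bounded_bilinear (scaleC :: complex \<Rightarrow> 'a::unital_cstar_algebra \<Rightarrow> 'a)"
  by unfold_locales
    (auto simp: scaleC_ring_simps scaleR_scaleC norm_scaleC scaleR_conv_of_real mult.commute
      intro!: exI[of _ 1])

lemmas tendsto_scaleC = bounded_bilinear.tendsto[OF bounded_bilinear_scaleC]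
lemmas continuous_on_scaleC = bounded_bilinear.continuous_on[OF bounded_bilinear_scaleC]

text \<open>The C*-identity squares the norm when the exponent doubles, hence exponents
  \<open>2 ^ k\<close>. A selfadjoint element of norm 1 keeps norm 1 in all these powers, which the
  spectral radius argument plays off against resolvents close to 1.\<close>

lemma selfadjoint_norm_power:
  fixes c :: "'a::unital_cstar_algebra"
  assumes "selfadjoint c"
  shows "norm (c ^ 2 ^ k) = norm c ^ 2 ^ k"
proof -
  have sa: "adj (c ^ n) = c ^ n" for n
  proof (induction n)
    case (Suc n)
    have "adj (c ^ Suc n) = adj (c ^ n) * adj c" by (simp add: adj_mult)
    also have "\<dots> = c ^ Suc n" using assms Suc by (simp add: selfadjoint_def power_commutes)
    finally show ?case .
  qed simp
  show ?thesis
  proof (induction k)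
    case (Suc k)
    have "c ^ 2 ^ Suc k = adj (c ^ 2 ^ k) * c ^ 2 ^ k"
      by (simp add: sa mult_2 flip: power_add)
    then have "norm (c ^ 2 ^ Suc k) = (norm c ^ 2 ^ k)\<^sup>2"
      by (metis Suc cstar_identity)
    also have "\<dots> = norm c ^ 2 ^ Suc k" by (simp add: mult.commute flip: power_mult)
    finally show ?case .
  qed simp
qed

subsection \<open>Invertibility and the spectrum\<close>

definition invertible_elt :: "'a::ring_1 \<Rightarrow> bool"
  where "invertible_elt x \<longleftrightarrow> (\<exists>y. x * y = 1 \<and> y * x = 1)"

definition inv_elt :: "'a::ring_1 \<Rightarrow> 'a"
  where "inv_elt x = (SOME y. x * y = 1 \<and> y * x = 1)"

lemma inv_elt:
  assumes "invertible_elt x"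
  shows "x * inv_elt x = 1" "inv_elt x * x = 1"
  using assms unfolding invertible_elt_def inv_elt_def by (metis (mono_tags, lifting) someI_ex)+

lemma inv_elt_unique:
  assumes "x * y = 1" "y * x = (1::'a::ring_1)"
  shows "inv_elt x = y"
  by (metis assms inv_elt(2) invertible_elt_def mult.assoc mult_1 mult_1_right)

lemma invertible_eltI:
  assumes "x * d = (1::'a::ring_1)" "d * y = 1"
  shows "invertible_elt d"
proof -
  have "x = x * (d * y)" using assms(2) by simp
  also have "\<dots> = y" using assms(1) by (simp flip: mult.assoc)
  finally show ?thesis using assms unfolding invertible_elt_def by blast
qed

lemma invertible_elt_mult:
  assumes "invertible_elt x" "invertible_elt y"
  shows "invertible_elt (x * y)"
proof -
  have "x * y * (inv_elt y * inv_elt x) = x * (y * inv_elt y) * inv_elt x"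
    "inv_elt y * inv_elt x * (x * y) = inv_elt y * (inv_elt x * x) * y"
    by (simp_all only: mult.assoc)
  with inv_elt[OF assms(1)] inv_elt[OF assms(2)] show ?thesis
    unfolding invertible_elt_def by (metis mult_1_right)
qed

lemma invertible_elt_scaleC:
  fixes x :: "'a::unital_cstar_algebra"
  assumes "invertible_elt x" "c \<noteq> 0"
  shows "invertible_elt (c *\<^sub>C x)"
proof -
  have "c *\<^sub>C x * (inverse c *\<^sub>C inv_elt x) = 1" "inverse c *\<^sub>C inv_elt x * c *\<^sub>C x = 1"
    using inv_elt[OF assms(1)] assms(2) by (simp_all add: scaleC_ring_simps)
  then show ?thesis unfolding invertible_elt_def by blast
qed

lemma in_spectrum_iff: "z \<in> spectrum a \<longleftrightarrow> \<not> invertible_elt (a - z *\<^sub>C 1)"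
  by (simp add: spectrum_def invertible_elt_def)

lemma invertible_one_minus:
  fixes x :: "'a::{real_normed_algebra_1,banach}"
  assumes "norm x < 1"
  shows "invertible_elt (1 - x)"
proof -
  have sm: "summable (\<lambda>n. x ^ n)"
    using assms by (rule complete_algebra_summable_geometric)
  let ?S = "\<Sum>n. x ^ n"
  have "x * ?S = (\<Sum>n. x ^ Suc n)" "?S * x = (\<Sum>n. x ^ Suc n)"
    using suminf_mult[OF sm, of x] suminf_mult2[OF sm, of x] by (simp_all add: power_commutes)
  moreover have "(\<Sum>n. x ^ Suc n) = ?S - 1"
    using suminf_split_head[OF sm] by simp
  ultimately have "(1 - x) * ?S = 1" "?S * (1 - x) = 1"
    by (simp_all add: algebra_simps)
  then show ?thesis unfolding invertible_elt_def by blast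
qed

lemma spectrum_norm_le:
  assumes "z \<in> spectrum a"
  shows "cmod z \<le> norm a"
proof (rule ccontr)
  assume lt: "\<not> cmod z \<le> norm a"
  then have z: "z \<noteq> 0" using norm_ge_zero[of a] by auto
  have "norm (inverse z *\<^sub>C a) < 1"
    using lt z by (simp add: norm_scaleC norm_inverse pos_divide_less_eq flip: divide_inverse_commute)
  from invertible_elt_scaleC[OF invertible_one_minus[OF this], of "- z"] z
  have "invertible_elt (a - z *\<^sub>C 1)" by (simp add: scaleC_ring_simps)
  with assms show False by (simp add: in_spectrum_iff)
qed

lemma compact_spectrum: "compact (spectrum a)"
proof -
  have "bounded (spectrum a)"
    using spectrum_norm_le by (auto simp: bounded_iff)
  moreover have "open (- spectrum a)"
  proof (rule openI)
    fix z assume "z \<in> - spectrum a"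
    then have inv: "invertible_elt (a - z *\<^sub>C 1)" by (simp add: in_spectrum_iff)
    define y where "y = inv_elt (a - z *\<^sub>C 1)"
    note y = inv_elt[OF inv, folded y_def]
    then have "y \<noteq> 0" by auto
    have "w \<in> - spectrum a" if "dist z w < 1 / norm y" for w
    proof -
      \<comment> \<open>This makes the second factor of
        \<open>a - w = (a - z) (1 - (w - z) y)\<close> invertible, whence the radius
        \<open>1 / norm y\<close>.\<close>
      have "norm ((w - z) *\<^sub>C y) < 1"
        using that \<open>y \<noteq> 0\<close> by (simp add: norm_scaleC dist_norm norm_minus_commute field_simps)
      from invertible_elt_mult[OF inv invertible_one_minus[OF this]]
      have "invertible_elt ((a - z *\<^sub>C 1) - (w - z) *\<^sub>C ((a - z *\<^sub>C 1) * y))"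
        by (simp add: algebra_simps scaleC_ring_simps)
      then have "invertible_elt (a - w *\<^sub>C 1)"
        by (simp add: y scaleC_diff_left)
      then show ?thesis by (simp add: in_spectrum_iff)
    qed
    then show "\<exists>e>0. ball z e \<subseteq> - spectrum a"
      using \<open>y \<noteq> 0\<close> by (intro exI[of _ "1 / norm y"]) auto
  qed
  ultimately show ?thesis
    using compact_eq_bounded_closed closed_def by blast
qed

text \<open>Adding \<open>\<i> t\<close> moves a spectral point to height \<open>Im z + t\<close>,
  while the C*-identity bounds the squared norm of the shifted element by
  \<open>norm a ^ 2 + t ^ 2\<close>. The terms \<open>t ^ 2\<close> cancel, and a bound on a linear
  function of arbitrary real \<open>t\<close> forces \<open>Im z = 0\<close>.\<close>

lemma spectrum_selfadjoint_real:
  assumes "selfadjoint a" and "z \<in> spectrum a"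
  shows "Im z = 0"
proof -
  have key: "2 * t * Im z \<le> (norm a)\<^sup>2" for t :: real
  proof -
    let ?u = "a + (\<i> * of_real t) *\<^sub>C 1"
    have "z + \<i> * of_real t \<in> spectrum ?u"
      using assms(2) by (simp add: in_spectrum_iff scaleC_add_left)
    then have "(cmod (z + \<i> * of_real t))\<^sup>2 \<le> (norm ?u)\<^sup>2"
      by (intro power_mono spectrum_norm_le) auto
    also have "\<dots> = norm (adj ?u * ?u)" by (simp add: cstar_identity)
    also have "adj ?u * ?u = a * a + (of_real (t\<^sup>2)) *\<^sub>C 1"
      using assms(1) unfolding selfadjoint_def
      by (simp add: adj_simps algebra_simps scaleC_ring_simps power2_eq_square)
    also have "norm \<dots> \<le> norm a * norm a + t\<^sup>2"
      by (rule order_trans[OF norm_triangle_ineq])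
        (auto intro!: add_mono norm_mult_ineq simp: norm_scaleC norm_power)
    finally have "(Re z)\<^sup>2 + (Im z + t)\<^sup>2 \<le> norm a * norm a + t\<^sup>2"
      by (simp add: cmod_power2)
    then have "(Re z)\<^sup>2 + (Im z)\<^sup>2 + 2 * t * Im z \<le> (norm a)\<^sup>2"
      by (simp add: power2_eq_square algebra_simps)
    moreover have "0 \<le> (Re z)\<^sup>2 + (Im z)\<^sup>2" by simp
    ultimately show ?thesis by linarith
  qed
  show ?thesis
  proof (rule ccontr)
    assume nz: "Im z \<noteq> 0"
    from key[of "((norm a)\<^sup>2 + 1) / (2 * Im z)"] nz show False by simp
  qed
qed

text \<open>For inverses \<open>x\<close>, \<open>y\<close> of \<open>f w\<close>,
  \<open>f z\<close> one has \<open>x - y = - x (f w - f z) y\<close>. Used once with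
  \<open>norm (f w - f z) < 1 / (2 * norm y)\<close>, this gives
  \<open>norm x \<le> 2 * norm y\<close>; used again, it gives convergence.\<close>

lemma continuous_on_inv_elt:
  fixes f :: "complex \<Rightarrow> 'a::unital_cstar_algebra"
  assumes f: "continuous_on S f" and inv: "\<And>z. z \<in> S \<Longrightarrow> invertible_elt (f z)"
  shows "continuous_on S (\<lambda>z. inv_elt (f z))"
  unfolding continuous_on_def
proof
  fix z assume z: "z \<in> S"
  let ?F = "at z within S" and ?y = "inv_elt (f z)"
  have lim: "(f \<longlongrightarrow> f z) ?F" using f z by (simp add: continuous_on_def)
  note iz = inv_elt[OF inv[OF z]]
  then have y0: "norm ?y > 0" by auto
  have "((\<lambda>w. 2 * norm ?y * norm ?y * norm (f w - f z)) \<longlongrightarrow> 0) ?F"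
    by (rule tendsto_eq_intros lim | simp)+
  moreover have "\<forall>\<^sub>F w in ?F. norm (inv_elt (f w) - ?y) \<le> 2 * norm ?y * norm ?y * norm (f w - f z)"
  proof -
    have "((\<lambda>w. norm (f w - f z)) \<longlongrightarrow> 0) ?F"
      by (rule tendsto_eq_intros lim | simp)+
    then have "\<forall>\<^sub>F w in ?F. norm (f w - f z) < 1 / (2 * norm ?y)"
      by (rule order_tendstoD) (use y0 in simp)
    moreover have "\<forall>\<^sub>F w in ?F. w \<in> S" by (simp add: eventually_at_filter)
    ultimately show ?thesis
    proof eventually_elim
      case (elim w)
      let ?x = "inv_elt (f w)"
      note iw = inv_elt[OF inv[OF elim(2)]]
      have eq: "?x - ?y = - (?x * (f w - f z) * ?y)"
      proof -
        have "?x * (f w - f z) * ?y = (?x * f w) * ?y - ?x * (f z * ?y)"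
          by (simp add: algebra_simps)
        then show ?thesis using iw iz by simp
      qed
      have b: "norm (?x - ?y) \<le> norm ?x * norm (f w - f z) * norm ?y"
        unfolding eq norm_minus_cancel
        by (intro order_trans[OF norm_mult_ineq] mult_right_mono norm_mult_ineq) auto
      also have "\<dots> \<le> norm ?x * (1 / (2 * norm ?y)) * norm ?y"
        using elim(1) by (intro mult_right_mono mult_left_mono) auto
      also have "\<dots> = norm ?x / 2" using y0 by simp
      finally have "norm ?x \<le> 2 * norm ?y"
        using norm_triangle_ineq2[of ?x ?y] by linarith
      then have "norm ?x * norm (f w - f z) * norm ?y \<le> 2 * norm ?y * norm (f w - f z) * norm ?y"
        by (intro mult_right_mono) auto
      with b show ?case by (simp add: mult_ac)
    qed
  qed
  ultimately have "((\<lambda>w. inv_elt (f w) - ?y) \<longlongrightarrow> 0) ?F"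
    by (rule Lim_null_comparison[rotated])
  then show "((\<lambda>w. inv_elt (f w)) \<longlongrightarrow> ?y) ?F" by (rule LIM_zero_cancel)
qed

text \<open>Rickart's argument: averaging resolvents over roots of unity shows that the resolvents
  of the powers of \<open>u\<close> inherit the modulus of continuity of the resolvent of \<open>u\<close>.\<close>

lemma selfadjoint_spectral_radius:
  fixes c :: "'a::unital_cstar_algebra"
  assumes sa: "selfadjoint c"
  obtains z where "z \<in> spectrum c" "norm c \<le> cmod z"
proof (cases "c = 0")
  case True
  have "0 \<in> spectrum (0::'a)" by (simp add: in_spectrum_iff invertible_elt_def)
  with True that[of 0] show thesis by simp
next
  case False
  define u where "u = inverse (of_real (norm c)) *\<^sub>C c"
  have u1: "norm u = 1" using False by (simp add: u_def norm_scaleC norm_inverse)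
  have usa: "selfadjoint u" using sa by (simp add: selfadjoint_def u_def adj_scaleC)
  have "\<exists>z. cmod z \<le> 1 \<and> \<not> invertible_elt (1 - z *\<^sub>C u)"
  proof (rule ccontr)
    assume "\<not> ?thesis"
    then have inv: "invertible_elt (1 - z *\<^sub>C u)" if "cmod z \<le> 1" for z
      using that by auto
    define G where "G k z = inv_elt (1 - (z ^ 2 ^ k) *\<^sub>C (u ^ 2 ^ k))" for k :: nat and z
    have pw: "1 - (z ^ 2 ^ Suc k) *\<^sub>C (u ^ 2 ^ Suc k) =
        (1 - (z ^ 2 ^ k) *\<^sub>C (u ^ 2 ^ k)) * (1 + (z ^ 2 ^ k) *\<^sub>C (u ^ 2 ^ k))" for k z
      by (simp add: algebra_simps scaleC_ring_simps mult_2 flip: power_add)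
    have rot: "\<exists>\<eta>. cmod \<eta> = 1 \<and> \<eta> ^ 2 ^ k = -1" for k :: nat
    proof (intro exI conjI)
      have "cis (pi / 2 ^ k) ^ 2 ^ k = cis (real (2 ^ k) * (pi / 2 ^ k))"
        by (rule Complex.DeMoivre)
      also have "real (2 ^ k) * (pi / 2 ^ k) = pi" by simp
      finally show "cis (pi / 2 ^ k) ^ 2 ^ k = -1" by simp
    qed simp
    have invk: "invertible_elt (1 - (z ^ 2 ^ k) *\<^sub>C (u ^ 2 ^ k))" if "cmod z \<le> 1" for k z
      using that
    proof (induction k arbitrary: z)
      case 0
      then show ?case using inv by simp
    next
      case (Suc k)
      obtain \<eta> where \<eta>: "cmod \<eta> = 1" "\<eta> ^ 2 ^ k = -1" using rot by blast
      have "invertible_elt (1 + (z ^ 2 ^ k) *\<^sub>C (u ^ 2 ^ k))"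
        using Suc.IH[of "\<eta> * z"] Suc.prems \<eta>
        by (simp add: norm_mult power_mult_distrib scaleC_minus_left)
      with Suc show ?case unfolding pw by (intro invertible_elt_mult)
    qed
    \<comment> \<open>Partial fractions: the inverse of \<open>1 - w * w\<close> is the mean of the
      inverses of \<open>1 - w\<close> and \<open>1 + w\<close>. Rotating \<open>z\<close> by
      \<open>\<eta>\<close> replaces \<open>w\<close> by \<open>- w\<close>.\<close>
    have avg: "G (Suc k) z = (1/2) *\<^sub>C (G k z + G k (\<eta> * z))"
      if z: "cmod z \<le> 1" and \<eta>: "cmod \<eta> = 1" "\<eta> ^ 2 ^ k = -1" for k z \<eta>
    proof -
      define w where "w = (z ^ 2 ^ k) *\<^sub>C (u ^ 2 ^ k)"
      have i1: "invertible_elt (1 - w)" using invk[OF z] by (simp add: w_def)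
      have e2: "1 - ((\<eta> * z) ^ 2 ^ k) *\<^sub>C (u ^ 2 ^ k) = 1 + w"
        by (simp add: w_def power_mult_distrib \<eta> scaleC_minus_left)
      have i2: "invertible_elt (1 + w)"
        using invk[of "\<eta> * z" k] z \<eta> unfolding e2[symmetric] by (simp add: norm_mult)
      define x where "x = inv_elt (1 - w)"
      define y where "y = inv_elt (1 + w)"
      note x = inv_elt[OF i1, folded x_def] and y = inv_elt[OF i2, folded y_def]
      have com: "(1 - w) * (1 + w) = (1 + w) * (1 - w)" by (simp add: algebra_simps)
      have half: "(1/2) *\<^sub>C ((1::'a) + 1) = 1"
        unfolding scaleC_add_right scaleC_add_left[symmetric] by simp
      have p1: "(1 - w) * (1 + w) * x = 1 + w"
        unfolding com by (simp add: mult.assoc x)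
      have p2: "(1 - w) * (1 + w) * y = 1 - w"
        by (simp add: mult.assoc y)
      have p3: "x * ((1 - w) * (1 + w)) = 1 + w"
        by (simp add: x flip: mult.assoc)
      have p4: "y * ((1 - w) * (1 + w)) = 1 - w"
        unfolding com by (simp add: y flip: mult.assoc)
      have "(1 - w) * (1 + w) * (x + y) = 1 + 1" "(x + y) * ((1 - w) * (1 + w)) = 1 + 1"
        unfolding distrib_left[of "(1 - w) * (1 + w)"] distrib_right[of x y] p1 p2 p3 p4
        by simp_all
      then have "inv_elt ((1 - w) * (1 + w)) = (1/2) *\<^sub>C (x + y)"
        by (intro inv_elt_unique) (simp_all only: mult_scaleC_left mult_scaleC_right half)
      then show ?thesis
        unfolding G_def pw e2 x_def y_def by (simp add: w_def)
    qed
    have "continuous_on (cball 0 1) (\<lambda>z. inv_elt (1 - z *\<^sub>C u))"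
      by (intro continuous_on_inv_elt continuous_intros continuous_on_scaleC) (use inv in auto)
    then have "continuous_on (cball 0 1) (G 0)" by (simp add: G_def[abs_def])
    then have "uniformly_continuous_on (cball 0 1) (G 0)"
      by (rule compact_uniformly_continuous) simp
    then have "\<exists>d>0. \<forall>z\<in>cball 0 1. \<forall>w\<in>cball 0 1. dist w z < d \<longrightarrow> dist (G 0 w) (G 0 z) < 1/8"
      unfolding uniformly_continuous_on_def by (elim allE[of _ "1/8"]) simp
    then obtain d where d: "d > 0" and ud: "\<And>z w. \<lbrakk>cmod z \<le> 1; cmod w \<le> 1; dist w z < d\<rbrakk> \<Longrightarrow>
        dist (G 0 w) (G 0 z) < 1/8"
      by auto
    define r where "r = max 0 (1 - d/2)"
    have r: "0 \<le> r" "r < 1" "1 - r < d" using d by (auto simp: r_def max_def)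
    \<comment> \<open>The bound survives the induction because \<open>G (Suc k)\<close> is a mean of
      two values of \<open>G k\<close>; one radius \<open>r\<close> below 1 serves all
      \<open>k\<close>.\<close>
    have step: "norm (G k z - G k (of_real r * z)) \<le> 1/8" if "cmod z \<le> 1" for k z
      using that
    proof (induction k arbitrary: z)
      case 0
      have "dist z (of_real r * z) = (1 - r) * cmod z"
      proof -
        have "z - of_real r * z = of_real (1 - r) * z" by (simp add: algebra_simps)
        then show ?thesis unfolding dist_norm using r by (simp only: norm_mult norm_of_real)
      qed
      also have "\<dots> \<le> 1 - r" using 0 r by (simp add: mult_left_le)
      finally have "dist z (of_real r * z) < d" using r by simp
      moreover have "cmod (of_real r * z) \<le> 1"
        using 0 r by (simp add: norm_mult mult_le_one)
      ultimately show ?case using ud[of "of_real r * z" z] 0 by (simp add: dist_norm)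
    next
      case (Suc k)
      obtain \<eta> where \<eta>: "cmod \<eta> = 1" "\<eta> ^ 2 ^ k = -1" using rot by blast
      have rz: "cmod (of_real r * z) \<le> 1"
        using Suc.prems r by (simp add: norm_mult mult_le_one)
      have "G (Suc k) z - G (Suc k) (of_real r * z) =
        (1/2) *\<^sub>C ((G k z - G k (of_real r * z)) + (G k (\<eta> * z) - G k (of_real r * (\<eta> * z))))"
        unfolding avg[OF Suc.prems \<eta>] avg[OF rz \<eta>]
        by (simp add: scaleC_ring_simps mult_ac)
      then have "norm (G (Suc k) z - G (Suc k) (of_real r * z)) = (1/2) *
        norm ((G k z - G k (of_real r * z)) + (G k (\<eta> * z) - G k (of_real r * (\<eta> * z))))"
        by (simp add: norm_scaleC)
      also have "\<dots> \<le> (1/2) * (1/8 + 1/8)"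
        using Suc.IH[of z] Suc.IH[of "\<eta> * z"] Suc.prems \<eta>
        by (intro mult_left_mono order_trans[OF norm_triangle_ineq] add_mono)
          (auto simp: norm_mult)
      finally show ?case by simp
    qed
    have "(\<lambda>n. r ^ n) \<longlonglongrightarrow> 0" using r by (intro LIMSEQ_power_zero) simp
    then have "\<forall>\<^sub>F n in sequentially. r ^ n < 1/10" by (rule order_tendstoD) simp
    then obtain n0 where n0: "\<And>n. n \<ge> n0 \<Longrightarrow> r ^ n < 1/10"
      by (auto simp: eventually_sequentially)
    have "n0 \<le> 2 ^ n0" by (simp add: less_imp_le)
    then have rn: "r ^ 2 ^ n0 < 1/10" by (rule n0)
    \<comment> \<open>At radius \<open>r\<close> the element \<open>v\<close> has norm at most 1/10,
      so the inverse of \<open>1 - v\<close> is within 1/8 of 1. By \<open>step\<close> the inverse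
      of \<open>1 - w\<close> is then within 1/4 of 1, which leaves \<open>norm w\<close> at most
      1/2 although it is 1.\<close>
    define w where "w = u ^ 2 ^ n0"
    define v where "v = (of_real r ^ 2 ^ n0) *\<^sub>C w"
    have w1: "norm w = 1" using selfadjoint_norm_power[OF usa] u1 by (simp add: w_def)
    have v1: "norm v \<le> 1/10" using rn r w1 by (simp add: v_def norm_scaleC norm_power)
    have G1: "G n0 1 = inv_elt (1 - w)" and Gr: "G n0 (of_real r) = inv_elt (1 - v)"
      by (simp_all add: G_def w_def v_def)
    have iw: "invertible_elt (1 - w)" using invk[of 1 n0] by (simp add: w_def)
    have iv: "invertible_elt (1 - v)" using invk[of "of_real r" n0] r by (simp add: w_def v_def)
    define x where "x = inv_elt (1 - w)"
    define y where "y = inv_elt (1 - v)"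
    note x = inv_elt[OF iw, folded x_def] and y = inv_elt[OF iv, folded y_def]
    have "y - 1 = y * v" using y(2) by (simp add: algebra_simps)
    then have y1: "norm (y - 1) \<le> norm y * (1/10)"
      using norm_mult_ineq[of y v] v1 by (metis mult_left_mono norm_ge_zero order_trans)
    have "norm y \<le> norm (y - 1) + 1" using norm_triangle_ineq[of "y - 1" 1] by simp
    with y1 have "norm (y - 1) \<le> 1/8" by linarith
    moreover have "norm (x - y) \<le> 1/8"
      using step[of 1 n0] unfolding G1 mult_1_right Gr x_def y_def by simp
    ultimately have x1: "norm (x - 1) \<le> 1/4"
      using norm_triangle_ineq[of "x - y" "y - 1"] by simp
    have "w = (x - 1) * (1 - w)" using x by (simp add: algebra_simps)
    then have "norm w \<le> norm (x - 1) * norm (1 - w)" by (metis norm_mult_ineq)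
    also have "\<dots> \<le> 1/4 * 2"
      using norm_triangle_ineq4[of 1 w] w1 by (intro mult_mono x1) auto
    finally show False using w1 by simp
  qed
  then obtain z where z: "cmod z \<le> 1" "\<not> invertible_elt (1 - z *\<^sub>C u)" by blast
  have z0: "z \<noteq> 0"
  proof
    assume "z = 0"
    then have "invertible_elt (1 - z *\<^sub>C u)" by (auto simp: invertible_elt_def)
    with z show False by simp
  qed
  \<comment> \<open>\<open>1 - z u\<close> is a nonzero multiple of \<open>c - ?m\<close>, and
    \<open>cmod z \<le> 1\<close> makes \<open>cmod ?m\<close> at least
    \<open>norm c\<close>.\<close>
  let ?m = "of_real (norm c) / z"
  have "?m \<in> spectrum c"
  proof (rule ccontr)
    assume "?m \<notin> spectrum c"
    then have "invertible_elt (c - ?m *\<^sub>C 1)" by (simp add: in_spectrum_iff)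
    then have "invertible_elt ((- inverse ?m) *\<^sub>C (c - ?m *\<^sub>C 1))"
      using z0 False by (intro invertible_elt_scaleC) auto
    also have "(- inverse ?m) *\<^sub>C (c - ?m *\<^sub>C 1) = 1 - z *\<^sub>C u"
      using z0 False by (simp add: u_def scaleC_ring_simps field_simps)
    finally show False using z by simp
  qed
  moreover have "norm c \<le> cmod ?m"
    using z z0 by (simp add: norm_divide field_simps mult_left_le)
  ultimately show thesis by (rule that)
qed

subsection \<open>Continuous functions of selfadjoint elements\<close>

text \<open>A relation between functions and elements stands in for a type of polynomials in
  \<open>z\<close> and \<open>cnj z\<close>. It may be multivalued if \<open>a\<close> is not
  normal: \<open>z * cnj z\<close> is related to both \<open>a * adj a\<close> and
  \<open>adj a * a\<close>.\<close>

inductive star_poly :: "'a::unital_cstar_algebra \<Rightarrow> (complex \<Rightarrow> complex) \<Rightarrow> 'a \<Rightarrow> bool"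
  for a where
  const: "star_poly a (\<lambda>_. c) (c *\<^sub>C 1)"
| ident: "star_poly a (\<lambda>z. z) a"
| cnj: "star_poly a cnj (adj a)"
| add: "star_poly a f x \<Longrightarrow> star_poly a g y \<Longrightarrow> star_poly a (\<lambda>z. f z + g z) (x + y)"
| mult: "star_poly a f x \<Longrightarrow> star_poly a g y \<Longrightarrow> star_poly a (\<lambda>z. f z * g z) (x * y)"

lemma star_poly_scaleC:
  assumes "star_poly a f x"
  shows "star_poly a (\<lambda>z. c * f z) (c *\<^sub>C x)"
  using star_poly.mult[OF star_poly.const[of a c] assms] by (simp add: mult_scaleC_left)

lemma star_poly_diff:
  assumes "star_poly a f x" "star_poly a g y"
  shows "star_poly a (\<lambda>z. f z - g z) (x - y)"
  using star_poly.add[OF assms(1) star_poly_scaleC[OF assms(2), of "-1"]]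
  by (simp add: scaleC_minus_left)

lemma star_poly_adj:
  assumes "star_poly a f x"
  shows "star_poly a (\<lambda>z. cnj (f z)) (adj x)"
  using assms
proof induction
  case (const c)
  show ?case using star_poly.const[of a "cnj c"] by (simp add: adj_scaleC)
next
  case (mult f x g y)
  from star_poly.mult[OF mult.IH(2,1)] show ?case by (simp add: adj_mult mult.commute)
qed (auto intro: star_poly.intros simp: adj_add adj_adj)

lemma star_poly_continuous: "star_poly a f x \<Longrightarrow> continuous_on S f"
  by (induction rule: star_poly.induct) (auto intro!: continuous_intros)

lemma star_poly_commute:
  assumes "star_poly a f x" and "w * a = a * w" "w * adj a = adj a * w"
  shows "w * x = x * w"
  using assms(1)
proof induction
  case (mult f x g y)
  have "w * (x * y) = (w * x) * y" by (simp only: mult.assoc)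
  also have "\<dots> = x * (w * y)" unfolding mult.IH(1) by (simp only: mult.assoc)
  also have "\<dots> = x * y * w" unfolding mult.IH(2) by (simp only: mult.assoc)
  finally show ?case .
qed (use assms in \<open>simp_all add: scaleC_ring_simps distrib_left distrib_right\<close>)

lemma real_polynomial_star_poly:
  fixes p :: "complex \<Rightarrow> real"
  assumes "real_polynomial_function p"
  shows "\<exists>x. star_poly a (\<lambda>z. of_real (p z)) x"
  using assms
proof induction
  case (linear p)
  \<comment> \<open>A real-linear functional on the complex plane is the real part of
    \<open>2 * c * z\<close> for one \<open>c\<close>; evaluation at 1 and \<open>\<i>\<close>
    yields this \<open>c\<close>.\<close>
  define c where "c = (of_real (p 1) - \<i> * of_real (p \<i>)) / 2"
  have eq: "complex_of_real (p z) = c * z + cnj c * cnj z" for z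
  proof -
    have "p z = p (Re z *\<^sub>R 1 + Im z *\<^sub>R \<i>)"
      by (rule arg_cong[of _ _ p]) (simp add: complex_eq_iff)
    also have "\<dots> = Re z * p 1 + Im z * p \<i>"
      using linear by (simp add: bounded_linear.linear linear_add linear_scale)
    finally show ?thesis by (simp add: c_def complex_eq_iff field_simps)
  qed
  from star_poly.add[OF star_poly_scaleC[OF star_poly.ident, where c = c and a = a]
      star_poly_scaleC[OF star_poly.cnj, where c = "cnj c" and a = a]]
  show ?case unfolding eq by blast
next
  case (const c)
  show ?case using star_poly.const[of a "of_real c"] by blast
next
  case (add f g)
  then show ?case using star_poly.add[of a] by fastforce
next
  case (mult f g)
  then show ?case using star_poly.mult[of a] by fastforce
qed

lemma star_poly_dense:
  fixes a :: "'a::unital_cstar_algebra"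
  assumes "compact K" "continuous_on K f" "e > 0"
  shows "\<exists>g x. star_poly a g x \<and> (\<forall>z\<in>K. cmod (f z - g z) < e)"
proof -
  have "e / 2 > 0" using assms by simp
  obtain p where p: "real_polynomial_function p" "\<And>z. z \<in> K \<Longrightarrow> \<bar>Re (f z) - p z\<bar> < e / 2"
    using Stone_Weierstrass_real_polynomial_function[of K "\<lambda>z. Re (f z)" "e / 2"] assms \<open>e / 2 > 0\<close>
    by (metis continuous_on_Re)
  obtain q where q: "real_polynomial_function q" "\<And>z. z \<in> K \<Longrightarrow> \<bar>Im (f z) - q z\<bar> < e / 2"
    using Stone_Weierstrass_real_polynomial_function[of K "\<lambda>z. Im (f z)" "e / 2"] assms \<open>e / 2 > 0\<close>
    by (metis continuous_on_Im)
  obtain x y where x: "star_poly a (\<lambda>z. of_real (p z)) x" and y: "star_poly a (\<lambda>z. of_real (q z)) y"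
    using real_polynomial_star_poly p(1) q(1) by metis
  let ?g = "\<lambda>z. of_real (p z) + \<i> * of_real (q z)"
  have "star_poly a ?g (x + \<i> *\<^sub>C y)"
    by (intro star_poly.add x star_poly_scaleC y)
  moreover have "cmod (f z - ?g z) < e" if "z \<in> K" for z
  proof -
    have "cmod (f z - ?g z) \<le> \<bar>Re (f z - ?g z)\<bar> + \<bar>Im (f z - ?g z)\<bar>" by (rule cmod_le)
    also have "\<dots> < e" using p(2)[OF that] q(2)[OF that] by simp
    finally show ?thesis .
  qed
  ultimately show ?thesis by blast
qed

text \<open>The graph of \<open>f \<mapsto> f(a)\<close> on \<open>C(K)\<close>, as a closure. It need not be single-valued unless
  \<open>spectral_bound a K\<close> holds.\<close>

definition calc_rel ::
    "'a::unital_cstar_algebra \<Rightarrow> complex set \<Rightarrow> (complex \<Rightarrow> complex) \<Rightarrow> 'a \<Rightarrow> bool"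
  where "calc_rel a K f x \<longleftrightarrow>
    (\<exists>g y. (\<forall>n. star_poly a (g n) (y n)) \<and> uniform_limit K g f sequentially \<and> y \<longlonglongrightarrow> x)"

text \<open>Contractivity on star-polynomials makes approximating sequences Cauchy and their limits
  unique, which is what extension to \<open>C(K)\<close> requires. It is established twice: on a
  real interval for selfadjoint elements and then, by means of the resulting bump functions, on the
  spectrum of a normal element.\<close>

definition spectral_bound :: "'a::unital_cstar_algebra \<Rightarrow> complex set \<Rightarrow> bool"
  where "spectral_bound a K \<longleftrightarrow>
    compact K \<and> (\<forall>f x m. star_poly a f x \<longrightarrow> (\<forall>z\<in>K. cmod (f z) \<le> m) \<longrightarrow> norm x \<le> m)"

lemma calc_rel_star_poly: "star_poly a f x \<Longrightarrow> calc_rel a K f x"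
  unfolding calc_rel_def
  by (rule exI[of _ "\<lambda>_. f"], rule exI[of _ "\<lambda>_. x"]) (auto intro: uniform_limit_const)

lemma calc_rel_cong:
  assumes "calc_rel a K f x" "\<And>z. z \<in> K \<Longrightarrow> f z = g z"
  shows "calc_rel a K g x"
proof -
  have "uniform_limit K h g F \<longleftrightarrow> uniform_limit K h f F" for h :: "nat \<Rightarrow> complex \<Rightarrow> complex" and F
    using assms(2) by (simp add: uniform_limit_iff)
  with assms(1) show ?thesis by (simp add: calc_rel_def)
qed

lemma calc_rel_continuous:
  assumes "calc_rel a K f x"
  shows "continuous_on K f"
proof -
  obtain g y where g: "\<And>n. star_poly a (g n) (y n)" "uniform_limit K g f sequentially"
    using assms by (auto simp: calc_rel_def)
  show ?thesis
    using uniform_limit_theorem[OF always_eventually g(2)] star_poly_continuous[OF g(1)] by simp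
qed

lemma calc_rel_add:
  assumes "calc_rel a K f x" "calc_rel a K g y"
  shows "calc_rel a K (\<lambda>z. f z + g z) (x + y)"
proof -
  from assms obtain f' x' g' y' where *:
    "\<And>n. star_poly a (f' n) (x' n)" "uniform_limit K f' f sequentially" "x' \<longlonglongrightarrow> x"
    "\<And>n. star_poly a (g' n) (y' n)" "uniform_limit K g' g sequentially" "y' \<longlonglongrightarrow> y"
    unfolding calc_rel_def by blast
  have "\<forall>n. star_poly a (\<lambda>z. f' n z + g' n z) (x' n + y' n)" by (intro allI star_poly.add *)
  moreover have "uniform_limit K (\<lambda>n z. f' n z + g' n z) (\<lambda>z. f z + g z) sequentially"
    by (intro uniform_limit_intros *)
  moreover have "(\<lambda>n. x' n + y' n) \<longlonglongrightarrow> x + y" by (intro tendsto_intros *)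
  ultimately show ?thesis unfolding calc_rel_def
    by (intro exI[of _ "\<lambda>n z. f' n z + g' n z"] exI[of _ "\<lambda>n. x' n + y' n"]) simp
qed

lemma calc_rel_mult:
  assumes "calc_rel a K f x" "calc_rel a K g y" and K: "compact K"
  shows "calc_rel a K (\<lambda>z. f z * g z) (x * y)"
proof -
  from assms obtain f' x' g' y' where *:
    "\<And>n. star_poly a (f' n) (x' n)" "uniform_limit K f' f sequentially" "x' \<longlonglongrightarrow> x"
    "\<And>n. star_poly a (g' n) (y' n)" "uniform_limit K g' g sequentially" "y' \<longlonglongrightarrow> y"
    unfolding calc_rel_def by blast
  have bd: "bounded (f ` K)" "bounded (g ` K)"
    using assms by (auto intro!: compact_imp_bounded compact_continuous_image calc_rel_continuous)
  have "\<forall>n. star_poly a (\<lambda>z. f' n z * g' n z) (x' n * y' n)" by (intro allI star_poly.mult *)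
  moreover have "uniform_limit K (\<lambda>n z. f' n z * g' n z) (\<lambda>z. f z * g z) sequentially"
    by (intro uniform_lim_mult * bd)
  moreover have "(\<lambda>n. x' n * y' n) \<longlonglongrightarrow> x * y" by (intro tendsto_intros *)
  ultimately show ?thesis unfolding calc_rel_def
    by (intro exI[of _ "\<lambda>n z. f' n z * g' n z"] exI[of _ "\<lambda>n. x' n * y' n"]) simp
qed

lemma calc_rel_scaleC:
  assumes "calc_rel a K f x" "compact K"
  shows "calc_rel a K (\<lambda>z. c * f z) (c *\<^sub>C x)"
  using calc_rel_mult[OF calc_rel_star_poly[OF star_poly.const[of a c]] assms]
  by (simp add: mult_scaleC_left)

lemma calc_rel_diff:
  assumes "calc_rel a K f x" "calc_rel a K g y" "compact K"
  shows "calc_rel a K (\<lambda>z. f z - g z) (x - y)"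
  using calc_rel_add[OF assms(1) calc_rel_scaleC[OF assms(2,3), of "-1"]]
  by (simp add: scaleC_minus_left)

lemma calc_rel_adj:
  assumes "calc_rel a K f x"
  shows "calc_rel a K (\<lambda>z. cnj (f z)) (adj x)"
proof -
  from assms obtain f' x' where *:
    "\<And>n. star_poly a (f' n) (x' n)" "uniform_limit K f' f sequentially" "x' \<longlonglongrightarrow> x"
    unfolding calc_rel_def by blast
  have "\<forall>n. star_poly a (\<lambda>z. cnj (f' n z)) (adj (x' n))" by (intro allI star_poly_adj *)
  moreover have "uniform_limit K (\<lambda>n z. cnj (f' n z)) (\<lambda>z. cnj (f z)) sequentially"
    by (intro bounded_linear_cnj[THEN bounded_linear.uniform_limit] *)
  moreover have "(\<lambda>n. adj (x' n)) \<longlonglongrightarrow> adj x"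
    by (intro bounded_linear.tendsto[OF bounded_linear_adj] *)
  ultimately show ?thesis unfolding calc_rel_def
    by (intro exI[of _ "\<lambda>n z. cnj (f' n z)"] exI[of _ "\<lambda>n. adj (x' n)"]) simp
qed

lemma calc_rel_commute:
  assumes "calc_rel a K f x" and "w * a = a * w" "w * adj a = adj a * w"
  shows "w * x = x * w"
proof -
  obtain g y where g: "\<And>n. star_poly a (g n) (y n)" "y \<longlonglongrightarrow> x"
    using assms(1) by (auto simp: calc_rel_def)
  have "(\<lambda>n. w * y n) \<longlonglongrightarrow> w * x" "(\<lambda>n. y n * w) \<longlonglongrightarrow> x * w" by (intro tendsto_intros g)+
  moreover have "w * y n = y n * w" for n by (rule star_poly_commute[OF g(1) assms(2,3)])
  ultimately show ?thesis by (simp add: LIMSEQ_unique)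
qed

lemma calc_rel_norm_le:
  assumes "calc_rel a K f x" and K: "spectral_bound a K" and m: "\<And>z. z \<in> K \<Longrightarrow> cmod (f z) \<le> m"
  shows "norm x \<le> m"
proof (rule field_le_epsilon)
  fix e :: real assume "e > 0"
  obtain g y where g: "\<And>n. star_poly a (g n) (y n)" "uniform_limit K g f sequentially" "y \<longlonglongrightarrow> x"
    using assms(1) by (auto simp: calc_rel_def)
  have "\<forall>\<^sub>F n in sequentially. \<forall>z\<in>K. dist (g n z) (f z) < e"
    by (rule uniform_limitD[OF g(2) \<open>e > 0\<close>])
  then have ev: "\<forall>\<^sub>F n in sequentially. norm (y n) \<le> m + e"
  proof eventually_elim
    case (elim n)
    have "cmod (g n z) \<le> m + e" if "z \<in> K" for z
      using elim m[OF that] norm_triangle_sub[of "g n z" "f z"] that by (fastforce simp: dist_norm)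
    then show ?case using K g(1) unfolding spectral_bound_def by blast
  qed
  show "norm x \<le> m + e"
    by (rule tendsto_upperbound[OF tendsto_norm[OF g(3)] ev]) simp
qed

lemma calc_rel_unique:
  assumes "calc_rel a K f x" "calc_rel a K f y" "spectral_bound a K"
  shows "x = y"
proof -
  have "norm (x - y) \<le> 0"
    by (rule calc_rel_norm_le[OF calc_rel_diff[OF assms(1,2)] assms(3)])
      (use assms(3) in \<open>auto simp: spectral_bound_def\<close>)
  then show ?thesis by simp
qed

lemma calc_rel_exists:
  assumes K: "spectral_bound a K" and f: "continuous_on K f"
  shows "\<exists>x. calc_rel a K f x"
proof -
  have "\<exists>g y. star_poly a g y \<and> (\<forall>z\<in>K. cmod (f z - g z) < 1 / Suc n)" for n
    using K f by (intro star_poly_dense) (auto simp: spectral_bound_def)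
  then obtain g y where g: "\<And>n. star_poly a (g n) (y n)"
      and d: "\<And>n z. z \<in> K \<Longrightarrow> cmod (f z - g n z) < 1 / Suc n"
    by metis
  have small: "\<exists>N. \<forall>n\<ge>N. 1 / real (Suc n) < e" if "e > 0" for e :: real
  proof -
    obtain N where N: "1 / real (Suc N) < e" using nat_approx_posE[OF \<open>e > 0\<close>] by blast
    have "1 / real (Suc n) < e" if "n \<ge> N" for n
      using that by (intro le_less_trans[OF _ N] divide_left_mono) auto
    then show ?thesis by blast
  qed
  have ul: "uniform_limit K g f sequentially"
    unfolding uniform_limit_sequentially_iff
  proof (intro allI impI)
    fix e :: real assume "e > 0"
    from small[OF this] obtain N where N: "\<forall>n\<ge>N. 1 / real (Suc n) < e" by blast
    have "dist (g n z) (f z) < e" if "n \<ge> N" "z \<in> K" for n z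
      using d[OF that(2), of n] N that(1) by (fastforce simp: dist_norm norm_minus_commute)
    then show "\<exists>N. \<forall>n\<ge>N. \<forall>z\<in>K. dist (g n z) (f z) < e" by blast
  qed
  have "Cauchy y"
  proof (rule CauchyI)
    fix e :: real assume "e > 0"
    then have "e / 3 > 0" by simp
    from small[OF this] obtain N where N: "\<forall>n\<ge>N. 1 / real (Suc n) < e / 3" by blast
    have "norm (y m - y n) < e" if "m \<ge> N" "n \<ge> N" for m n
    proof -
      have "cmod (g m z - g n z) \<le> 2 * (e / 3)" if "z \<in> K" for z
      proof -
        have "cmod (f z - g m z) < e / 3" "cmod (f z - g n z) < e / 3"
          using N \<open>m \<ge> N\<close> \<open>n \<ge> N\<close> d[OF that] by (meson less_trans)+
        then show ?thesis using norm_triangle_ineq4[of "f z - g n z" "f z - g m z"] by simp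
      qed
      then have "norm (y m - y n) \<le> 2 * (e / 3)"
        using K star_poly_diff[OF g[of m] g[of n]] unfolding spectral_bound_def by blast
      then show ?thesis using \<open>e > 0\<close> by simp
    qed
    then show "\<exists>M. \<forall>m\<ge>M. \<forall>n\<ge>M. norm (y m - y n) < e" by blast
  qed
  then obtain x where "y \<longlonglongrightarrow> x" using Cauchy_convergent convergent_def by blast
  with g ul show ?thesis unfolding calc_rel_def by blast
qed

section \<open>Polynomials in one element and the norm bound for selfadjoint elements\<close>

definition poly_eval :: "'a::unital_cstar_algebra \<Rightarrow> complex poly \<Rightarrow> 'a"
  where "poly_eval a p = fold_coeffs (\<lambda>c y. c *\<^sub>C 1 + a * y) p 0"

lemma poly_eval_0 [simp]: "poly_eval a 0 = 0"
  by (simp add: poly_eval_def)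

lemma poly_eval_pCons [simp]: "poly_eval a (pCons c p) = c *\<^sub>C 1 + a * poly_eval a p"
  by (cases "p = 0 \<and> c = 0") (auto simp: poly_eval_def)

lemma poly_eval_add [simp]: "poly_eval a (p + q) = poly_eval a p + poly_eval a q"
  by (induction p q rule: poly_induct2) (auto simp: scaleC_add_left algebra_simps)

lemma poly_eval_smult [simp]: "poly_eval a (smult c p) = c *\<^sub>C poly_eval a p"
  by (induction p) (auto simp: scaleC_ring_simps)

lemma poly_eval_mult [simp]: "poly_eval a (p * q) = poly_eval a p * poly_eval a q"
  by (induction p) (auto simp: scaleC_ring_simps algebra_simps)

text \<open>Over the complex numbers \<open>p\<close> splits into linear factors, each invertible at
  \<open>a\<close> because its root lies off the spectrum. Applied to \<open>p - z\<close>, this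
  puts the spectrum of \<open>p(a)\<close> inside the image of the spectrum of
  \<open>a\<close>.\<close>

lemma invertible_poly_eval:
  fixes a :: "'a::unital_cstar_algebra"
  assumes "p \<noteq> 0" "\<And>r. poly p r = 0 \<Longrightarrow> r \<notin> spectrum a"
  shows "invertible_elt (poly_eval a p)"
  using assms
proof (induction "degree p" arbitrary: p)
  case 0
  then obtain c where p: "p = [:c:]" using degree_eq_zeroE by metis
  with 0 have "c \<noteq> 0" by simp
  have "invertible_elt (1::'a)" by (auto simp: invertible_elt_def)
  from invertible_elt_scaleC[OF this \<open>c \<noteq> 0\<close>] show ?case by (simp add: p)
next
  case (Suc n)
  then have "\<not> constant (poly p)" by (simp add: constant_degree)
  then obtain r where r: "poly p r = 0" using fundamental_theorem_of_algebra by blast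
  then obtain q where q: "p = [:-r, 1:] * q" by (auto simp: poly_eq_0_iff_dvd)
  with Suc.prems have "q \<noteq> 0" by auto
  then have "degree p = degree [:-r, 1:] + degree q" unfolding q by (intro degree_mult_eq) auto
  then have "degree p = Suc (degree q)" by simp
  then have "invertible_elt (poly_eval a q)"
    using Suc.hyps \<open>q \<noteq> 0\<close> Suc.prems(2) q by (metis Suc_inject mult_zero_right poly_mult)
  moreover have "invertible_elt (a - r *\<^sub>C 1)"
    using Suc.prems(2)[OF r] by (simp add: in_spectrum_iff)
  ultimately have "invertible_elt ((a - r *\<^sub>C 1) * poly_eval a q)"
    by (intro invertible_elt_mult)
  moreover have "poly_eval a [:-r, 1:] = a - r *\<^sub>C 1"
    by (simp add: scaleC_minus_left)
  ultimately show ?case unfolding q poly_eval_mult by simp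
qed

text \<open>On the real line \<open>cnj z\<close> is \<open>z\<close>, so a single variable remains,
  in which polynomials factor. Agreement with \<open>f\<close> is therefore asserted at real
  arguments.\<close>

lemma star_poly_selfadjoint:
  assumes "star_poly a f x" and "selfadjoint a"
  shows "\<exists>p. x = poly_eval a p \<and> (\<forall>t. f (of_real t) = poly p (of_real t))"
  using assms(1)
proof induction
  case (const c)
  show ?case by (rule exI[of _ "[:c:]"]) simp
next
  case ident
  show ?case by (rule exI[of _ "[:0, 1:]"]) simp
next
  case cnj
  show ?case using assms(2) by (intro exI[of _ "[:0, 1:]"]) (simp add: selfadjoint_def)
next
  case (add f x g y)
  then obtain p q where "x = poly_eval a p \<and> (\<forall>t. f (of_real t) = poly p (of_real t))"
    "y = poly_eval a q \<and> (\<forall>t. g (of_real t) = poly q (of_real t))" by blast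
  then show ?case by (intro exI[of _ "p + q"]) simp
next
  case (mult f x g y)
  then obtain p q where "x = poly_eval a p \<and> (\<forall>t. f (of_real t) = poly p (of_real t))"
    "y = poly_eval a q \<and> (\<forall>t. g (of_real t) = poly q (of_real t))" by blast
  then show ?case by (intro exI[of _ "p * q"]) simp
qed

definition real_segment :: "'a::unital_cstar_algebra \<Rightarrow> complex set"
  where "real_segment h = of_real ` {- norm h .. norm h}"

text \<open>The norm of \<open>adj x * x\<close> is dominated by the modulus of one of its spectral
  points. As this element is a polynomial in \<open>a\<close>, the spectral point is the value
  \<open>cnj (f t) * f t\<close> at a real \<open>t\<close> in the segment, and the C*-identity
  transfers the bound to \<open>x\<close>.\<close>

lemma spectral_bound_selfadjoint:
  assumes sa: "selfadjoint a"
  shows "spectral_bound a (real_segment a)"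
  unfolding spectral_bound_def
proof (intro conjI allI impI)
  show "compact (real_segment a)"
    unfolding real_segment_def by (intro compact_continuous_image continuous_intros compact_Icc)
next
  fix f x m assume f: "star_poly a f x" and m: "\<forall>z\<in>real_segment a. cmod (f z) \<le> m"
  let ?c = "adj x * x"
  have "star_poly a (\<lambda>z. cnj (f z) * f z) ?c"
    by (intro star_poly.mult star_poly_adj f)
  from star_poly_selfadjoint[OF this sa] obtain p where
    p: "?c = poly_eval a p" "\<And>t. cnj (f (of_real t)) * f (of_real t) = poly p (of_real t)" by blast
  have "selfadjoint ?c" by (simp add: selfadjoint_def adj_mult adj_adj)
  then obtain z where z: "z \<in> spectrum ?c" "norm ?c \<le> cmod z"
    by (rule selfadjoint_spectral_radius)
  have "\<exists>t. \<bar>t\<bar> \<le> norm a \<and> poly p (of_real t) = z"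
  proof (cases "p - [:z:] = 0")
    \<comment> \<open>A constant polynomial takes the value \<open>z\<close> everywhere, so any real
      point of the segment will do; 0 is taken.\<close>
    case True
    then have "p = [:z:]" by simp
    then show ?thesis by (intro exI[of _ 0]) simp
  next
    case False
    have "poly_eval a p = poly_eval a ((p - [:z:]) + [:z:])" by simp
    also have "\<dots> = poly_eval a (p - [:z:]) + z *\<^sub>C 1" unfolding poly_eval_add by simp
    finally have "\<not> invertible_elt (poly_eval a (p - [:z:]))"
      using z(1) by (simp add: in_spectrum_iff p(1))
    then obtain r where r: "poly (p - [:z:]) r = 0" "r \<in> spectrum a"
      using invertible_poly_eval[OF False] by blast
    then have "r = of_real (Re r)" "\<bar>Re r\<bar> \<le> norm a"
      using spectrum_selfadjoint_real[OF sa r(2)] spectrum_norm_le[OF r(2)]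
        order_trans[OF abs_Re_le_cmod[of r]] by (auto simp: complex_eq_iff)
    then show ?thesis using r(1) by (metis poly_diff poly_pCons poly_0 mult_zero_right add_0_right eq_iff_diff_eq_0)
  qed
  then obtain t where t: "\<bar>t\<bar> \<le> norm a" "poly p (of_real t) = z" by blast
  then have "of_real t \<in> real_segment a" by (auto simp: real_segment_def intro!: imageI)
  then have le: "cmod (f (of_real t)) \<le> m" using m by blast
  have "(norm x)\<^sup>2 \<le> cmod (cnj (f (of_real t)) * f (of_real t))"
    using z(2) t(2) p(2)[of t] by (simp add: cstar_identity)
  also have "\<dots> \<le> m\<^sup>2"
    using power_mono[OF le, of 2] by (simp add: norm_mult power2_eq_square)
  finally show "norm x \<le> m"
    using le by (meson norm_ge_zero order_trans power2_le_imp_le)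
qed

subsection \<open>Spectral localisation\<close>

text \<open>The element \<open>e\<close> plays the role of a spectral projection of \<open>a\<close> for a small
  neighbourhood of \<open>s\<close>.\<close>

definition approx_eigen :: "real \<Rightarrow> 'a::unital_cstar_algebra \<Rightarrow> complex \<Rightarrow> 'a \<Rightarrow> bool"
  where "approx_eigen \<delta> a s e \<longleftrightarrow>
    (\<forall>w. norm ((a - s *\<^sub>C 1) * (e * w)) \<le> \<delta> * norm (e * w) \<and>
         norm ((adj a - cnj s *\<^sub>C 1) * (e * w)) \<le> \<delta> * norm (e * w))"

lemma approx_eigenD:
  assumes "approx_eigen \<delta> a s e"
  shows "norm ((a - s *\<^sub>C 1) * (e * w)) \<le> \<delta> * norm (e * w)"
    and "norm ((adj a - cnj s *\<^sub>C 1) * (e * w)) \<le> \<delta> * norm (e * w)"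
  using assms by (auto simp: approx_eigen_def)

text \<open>The quantifier over \<open>w\<close> in the definition serves this purpose: localisation
  passes to right multiples, so a product of commuting localisers is localised for each of the
  elements concerned.\<close>

lemma approx_eigen_mult: "approx_eigen \<delta> a s e \<Longrightarrow> approx_eigen \<delta> a s (e * f)"
  by (simp add: approx_eigen_def mult.assoc)

lemma approx_eigen_mono: "approx_eigen \<delta> a s e \<Longrightarrow> \<delta> \<le> \<epsilon> \<Longrightarrow> approx_eigen \<epsilon> a s e"
  unfolding approx_eigen_def by (meson mult_right_mono norm_ge_zero order_trans)

lemma approx_eigen_shift:
  assumes "approx_eigen \<delta> a s e"
  shows "approx_eigen (\<delta> + cmod (s - t)) a t e"
  unfolding approx_eigen_def
proof (intro allI conjI)
  fix w
  have "(a - t *\<^sub>C 1) * (e * w) = (a - s *\<^sub>C 1) * (e * w) + (s - t) *\<^sub>C (e * w)"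
    by (simp add: scaleC_ring_simps algebra_simps)
  then show "norm ((a - t *\<^sub>C 1) * (e * w)) \<le> (\<delta> + cmod (s - t)) * norm (e * w)"
    using norm_triangle_ineq[of "(a - s *\<^sub>C 1) * (e * w)" "(s - t) *\<^sub>C (e * w)"]
      approx_eigenD(1)[OF assms, of w] by (simp add: norm_scaleC distrib_right)
  have "(adj a - cnj t *\<^sub>C 1) * (e * w) =
      (adj a - cnj s *\<^sub>C 1) * (e * w) + (cnj (s - t)) *\<^sub>C (e * w)"
    by (simp add: scaleC_ring_simps algebra_simps)
  then show "norm ((adj a - cnj t *\<^sub>C 1) * (e * w)) \<le> (\<delta> + cmod (s - t)) * norm (e * w)"
    using norm_triangle_ineq[of "(adj a - cnj s *\<^sub>C 1) * (e * w)" "cnj (s - t) *\<^sub>C (e * w)"]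
      approx_eigenD(2)[OF assms, of w] by (simp only: norm_scaleC complex_mod_cnj distrib_right)
qed

lemma approx_eigen_bound:
  assumes "approx_eigen \<delta> a s e" "e \<noteq> 0"
  shows "cmod s \<le> norm a + \<delta>"
proof -
  have "cmod s * norm e = norm (a * e - (a - s *\<^sub>C 1) * e)"
    by (simp add: scaleC_ring_simps norm_scaleC algebra_simps)
  also have "\<dots> \<le> norm a * norm e + \<delta> * norm e"
    using approx_eigenD(1)[OF assms(1), of 1]
    by (intro order_trans[OF norm_triangle_ineq4] add_mono norm_mult_ineq) simp
  also have "\<dots> = (norm a + \<delta>) * norm e" by (simp add: distrib_right)
  finally show ?thesis using assms(2) by simp
qed

section \<open>Bump functions of a selfadjoint element\<close>

lemma calc_real_exists:
  fixes \<phi> :: "real \<Rightarrow> real"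
  assumes "selfadjoint h" "continuous_on UNIV \<phi>"
  shows "\<exists>e. calc_rel h (real_segment h) (\<lambda>z. of_real (\<phi> (Re z))) e"
proof (rule calc_rel_exists[OF spectral_bound_selfadjoint[OF assms(1)]])
  show "continuous_on (real_segment h) (\<lambda>z. complex_of_real (\<phi> (Re z)))"
    by (intro continuous_intros continuous_on_compose2[OF assms(2)]) auto
qed

text \<open>On the support of \<open>\<phi>\<close> the factor \<open>x - t\<close> may be replaced
  by its truncation \<open>u\<close> to \<open>[-\<delta>, \<delta>]\<close>. Hence
  \<open>(h - t) e = u(h) e\<close> with \<open>u(h)\<close> of norm at most
  \<open>\<delta>\<close>. An identity of this kind can be multiplied by any \<open>w\<close>,
  whereas a bound on the norm of \<open>(h - t) e\<close> would say nothing relative to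
  \<open>norm (e * w)\<close>.\<close>

lemma approx_eigen_calc:
  fixes \<phi> :: "real \<Rightarrow> real"
  assumes sa: "selfadjoint h"
    and e: "calc_rel h (real_segment h) (\<lambda>z. of_real (\<phi> (Re z))) e"
    and supp: "\<And>x. \<bar>x\<bar> \<le> norm h \<Longrightarrow> \<phi> x \<noteq> 0 \<Longrightarrow> \<bar>x - t\<bar> \<le> \<delta>"
    and "0 \<le> \<delta>"
  shows "approx_eigen \<delta> h (of_real t) e"
proof -
  note sb = spectral_bound_selfadjoint[OF sa]
  then have cp: "compact (real_segment h)" by (simp add: spectral_bound_def)
  define u where "u x = max (-\<delta>) (min \<delta> (x - t))" for x
  obtain v where v: "calc_rel h (real_segment h) (\<lambda>z. of_real (u (Re z))) v"
    using calc_real_exists[OF sa, of u] unfolding u_def by (fastforce intro: continuous_intros)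
  have "norm v \<le> \<delta>"
    by (rule calc_rel_norm_le[OF v sb]) (use \<open>0 \<le> \<delta>\<close> in \<open>auto simp: u_def\<close>)
  have "calc_rel h (real_segment h) (\<lambda>z. (z - of_real t) * of_real (\<phi> (Re z))) ((h - of_real t *\<^sub>C 1) * e)"
    by (intro calc_rel_mult calc_rel_star_poly star_poly_diff star_poly.ident star_poly.const e cp)
  moreover have "(z - of_real t) * of_real (\<phi> (Re z)) = of_real (u (Re z)) * of_real (\<phi> (Re z))"
    if zK: "z \<in> real_segment h" for z
  proof -
    obtain x where "z = of_real x" "x \<in> {- norm h..norm h}"
      using zK unfolding real_segment_def by (elim imageE)
    then have x: "z = of_real x" "\<bar>x\<bar> \<le> norm h" by auto
    show ?thesis
    proof (cases "\<phi> x = 0")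
      case False
      then have "u x = x - t" using supp[OF x(2)] by (auto simp: u_def)
      then show ?thesis by (simp add: x(1))
    qed (simp add: x(1))
  qed
  ultimately have "calc_rel h (real_segment h) (\<lambda>z. of_real (u (Re z)) * of_real (\<phi> (Re z)))
      ((h - of_real t *\<^sub>C 1) * e)"
    by (rule calc_rel_cong)
  then have eq: "(h - of_real t *\<^sub>C 1) * e = v * e"
    using calc_rel_mult[OF v e cp] sb by (rule calc_rel_unique)
  have le: "norm ((h - of_real t *\<^sub>C 1) * (e * w)) \<le> \<delta> * norm (e * w)" for w
  proof -
    have "(h - of_real t *\<^sub>C 1) * (e * w) = v * (e * w)"
      by (simp only: mult.assoc[symmetric] eq)
    then show ?thesis
      using norm_mult_ineq[of v "e * w"] \<open>norm v \<le> \<delta>\<close>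
      by (metis mult_right_mono norm_ge_zero order_trans)
  qed
  then show ?thesis using sa by (simp add: approx_eigen_def selfadjoint_def)
qed

lemma calc_real_commute:
  assumes "selfadjoint h" "calc_rel h K f e" "w * h = h * w"
  shows "w * e = e * w"
  using calc_rel_commute[OF assms(2,3)] assms(1,3) by (simp add: selfadjoint_def)

text \<open>A given \<open>e \<noteq> 0\<close> is refined so that \<open>e * f\<close> stays
  nonzero; thus several elements can be localised one after another. The commutation clause lets the
  localisers be reordered.\<close>

lemma exists_approx_eigen_selfadjoint:
  assumes sa: "selfadjoint h" and e: "e \<noteq> 0" and \<delta>: "\<delta> > 0"
  obtains t f where "e * f \<noteq> 0" "approx_eigen \<delta> h (of_real t) f"
    "\<And>w. w * h = h * w \<Longrightarrow> w * f = f * w"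
proof -
  note sb = spectral_bound_selfadjoint[OF sa]
  then have cp: "compact (real_segment h)" by (simp add: spectral_bound_def)
  let ?R = "norm h"
  \<comment> \<open>\<open>g 0 = 1\<close> and \<open>g N = 0\<close> on the segment, so some difference \<open>g j - g (Suc j)\<close>, a hat function
    supported near \<open>j \<delta> - \<parallel>h\<parallel>\<close>, does not annihilate \<open>e\<close>.\<close>
  define g where "g j x = max 0 (min 1 ((x + ?R) / \<delta> + 1 - real j))" for j x
  have "continuous_on UNIV (g j)" for j
    unfolding g_def[abs_def] using \<delta> by (intro continuous_intros) auto
  then have "\<forall>j. \<exists>f. calc_rel h (real_segment h) (\<lambda>z. of_real (g j (Re z))) f"
    using calc_real_exists[OF sa] by blast
  then obtain F where F: "\<And>j. calc_rel h (real_segment h) (\<lambda>z. of_real (g j (Re z))) (F j)"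
    by metis
  have "F 0 = 1"
  proof (rule calc_rel_unique[OF F _ sb])
    have "calc_rel h (real_segment h) (\<lambda>_. 1) 1"
      using calc_rel_star_poly[OF star_poly.const[of h 1]] by simp
    then show "calc_rel h (real_segment h) (\<lambda>z. of_real (g 0 (Re z))) 1"
      by (rule calc_rel_cong)
        (use \<delta> in \<open>auto simp: real_segment_def g_def\<close>)
  qed
  obtain N :: nat where N: "2 * ?R / \<delta> + 1 \<le> real N" using real_arch_simple by blast
  have "F N = 0"
  proof (rule calc_rel_unique[OF F _ sb])
    have z: "g N x = 0" if "x \<le> ?R" for x
    proof -
      have "(x + ?R) / \<delta> \<le> 2 * ?R / \<delta>" using that \<delta> by (intro divide_right_mono) auto
      then show ?thesis using N by (simp add: g_def)
    qed
    have "calc_rel h (real_segment h) (\<lambda>_. 0) 0"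
      using calc_rel_star_poly[OF star_poly.const[of h 0]] by simp
    then show "calc_rel h (real_segment h) (\<lambda>z. of_real (g N (Re z))) 0"
      by (rule calc_rel_cong)
        (auto simp: real_segment_def z)
  qed
  have "\<exists>j. e * F j \<noteq> e * F (Suc j)"
  proof (rule ccontr)
    assume "\<not> ?thesis"
    then have "e * F j = e * F 0" for j by (induction j) auto
    from this[of N] show False using e \<open>F 0 = 1\<close> \<open>F N = 0\<close> by simp
  qed
  then obtain j where j: "e * F j \<noteq> e * F (Suc j)" by blast
  let ?f = "F j - F (Suc j)"
  have f: "calc_rel h (real_segment h) (\<lambda>z. of_real (g j (Re z) - g (Suc j) (Re z))) ?f"
    using calc_rel_diff[OF F F cp] by simp
  show thesis
  proof (rule that[of ?f "real j * \<delta> - ?R"])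
    show "e * ?f \<noteq> 0" using j by (simp add: right_diff_distrib)
    show "approx_eigen \<delta> h (of_real (real j * \<delta> - ?R)) ?f"
    proof (rule approx_eigen_calc[OF sa f])
      fix x assume nz: "g j x - g (Suc j) x \<noteq> 0"
      then have "real j \<le> (x + ?R) / \<delta> + 1" "(x + ?R) / \<delta> + 1 \<le> real j + 2"
        by (auto simp: g_def max_def min_def split: if_splits)
      then have "real j * \<delta> \<le> x + ?R + \<delta>" "x + ?R \<le> real j * \<delta> + \<delta>"
        using \<delta> by (simp_all add: field_simps)
      then show "\<bar>x - (real j * \<delta> - ?R)\<bar> \<le> \<delta>" by (simp add: abs_le_iff)
    qed (use \<delta> in simp)
    show "w * ?f = ?f * w" if "w * h = h * w" for w
      using calc_real_commute[OF sa f that] .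
  qed
qed

text \<open>The point \<open>l\<close> is fixed while the tolerance shrinks. The localisers commute
  with everything that commutes with \<open>c\<close>, which allows them to be combined with
  localisers of other elements.\<close>

definition spectral_peak :: "'a::unital_cstar_algebra \<Rightarrow> complex \<Rightarrow> bool"
  where "spectral_peak c l \<longleftrightarrow>
    (\<forall>\<delta>>0. \<exists>e. e \<noteq> 0 \<and> approx_eigen \<delta> c l e \<and> (\<forall>w. w * c = c * w \<longrightarrow> w * e = e * w))"

lemma spectral_peak_norm:
  assumes sa: "selfadjoint c"
  shows "\<exists>l. cmod l = norm c \<and> spectral_peak c l"
proof (cases "c = 0")
  case True
  have "approx_eigen \<delta> 0 0 (1::'a)" if "\<delta> > 0" for \<delta>
    using that by (simp add: approx_eigen_def)
  then have "spectral_peak (0::'a) 0" unfolding spectral_peak_def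
    by (intro allI impI exI[of _ 1]) auto
  then show ?thesis using True by auto
next
  case False
  note sb = spectral_bound_selfadjoint[OF sa]
  then have cp: "compact (real_segment c)" by (simp add: spectral_bound_def)
  let ?R = "norm c"
  have R: "?R > 0" using False by simp
  define Q where "Q \<sigma> \<delta> \<longleftrightarrow> (\<exists>e. e \<noteq> 0 \<and> approx_eigen \<delta> c (of_real (\<sigma> * ?R)) e \<and>
    (\<forall>w. w * c = c * w \<longrightarrow> w * e = e * w))" for \<sigma> \<delta>
  have mono: "Q \<sigma> \<delta> \<Longrightarrow> \<delta> \<le> \<epsilon> \<Longrightarrow> Q \<sigma> \<epsilon>" for \<sigma> \<delta> \<epsilon>
    using approx_eigen_mono[of \<delta> c _ _ \<epsilon>] unfolding Q_def by blast
  have or: "Q 1 \<delta> \<or> Q (-1) \<delta>" if "\<delta> > 0" "\<delta> < ?R" for \<delta>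
  proof -
    \<comment> \<open>\<open>x = u x + \<phi> 1 x - \<phi> (-1) x\<close>; if both \<open>\<phi> \<sigma>\<close> vanished at \<open>c\<close>, then \<open>c = u(c)\<close> would be too short.\<close>
    define \<phi> where "\<phi> \<sigma> x = max 0 (\<sigma> * x - (?R - \<delta>))" for \<sigma> x :: real
    define u where "u x = max (-(?R - \<delta>)) (min (?R - \<delta>) x)" for x
    have "continuous_on UNIV (\<phi> \<sigma>)" for \<sigma>
      unfolding \<phi>_def[abs_def] by (intro continuous_intros)
    then have "\<forall>\<sigma>. \<exists>e. calc_rel c (real_segment c) (\<lambda>z. of_real (\<phi> \<sigma> (Re z))) e"
      using calc_real_exists[OF sa] by blast
    then obtain E where E: "\<And>\<sigma>. calc_rel c (real_segment c) (\<lambda>z. of_real (\<phi> \<sigma> (Re z))) (E \<sigma>)"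
      by metis
    have "continuous_on UNIV u" unfolding u_def[abs_def] by (intro continuous_intros)
    then obtain v where v: "calc_rel c (real_segment c) (\<lambda>z. of_real (u (Re z))) v"
      using calc_real_exists[OF sa] by blast
    have vle: "norm v \<le> ?R - \<delta>"
      by (rule calc_rel_norm_le[OF v sb]) (use that in \<open>auto simp: u_def\<close>)
    have "calc_rel c (real_segment c)
        (\<lambda>z. of_real (u (Re z)) + (of_real (\<phi> 1 (Re z)) - of_real (\<phi> (-1) (Re z)))) (v + (E 1 - E (-1)))"
      by (intro calc_rel_add calc_rel_diff v E cp)
    then have "calc_rel c (real_segment c) (\<lambda>z. z) (v + (E 1 - E (-1)))"
    proof (rule calc_rel_cong)
      fix z assume "z \<in> real_segment c"
      then obtain x where "z = of_real x" by (auto simp: real_segment_def)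
      moreover have "u x + (\<phi> 1 x - \<phi> (-1) x) = x"
        using that by (auto simp: u_def \<phi>_def max_def min_def)
      ultimately show "of_real (u (Re z)) + (of_real (\<phi> 1 (Re z)) - of_real (\<phi> (-1) (Re z))) = z"
        by (simp flip: of_real_add of_real_diff)
    qed
    then have c: "c = v + (E 1 - E (-1))"
      by (rule calc_rel_unique[OF calc_rel_star_poly[OF star_poly.ident] _ sb])
    have "E 1 \<noteq> 0 \<or> E (-1) \<noteq> 0"
    proof (rule ccontr)
      assume "\<not> ?thesis"
      then show False using c vle that by simp
    qed
    moreover have "Q \<sigma> \<delta>" if \<sigma>: "\<sigma> = 1 \<or> \<sigma> = -1" and "E \<sigma> \<noteq> 0" for \<sigma>
    proof -
      have "approx_eigen \<delta> c (of_real (\<sigma> * ?R)) (E \<sigma>)"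
      proof (rule approx_eigen_calc[OF sa E])
        fix x assume "\<bar>x\<bar> \<le> norm c" "\<phi> \<sigma> x \<noteq> 0"
        then show "\<bar>x - \<sigma> * norm c\<bar> \<le> \<delta>"
          using \<sigma> by (auto simp: \<phi>_def max_def abs_le_iff split: if_splits)
      qed (use \<open>\<delta> > 0\<close> in simp)
      then show ?thesis unfolding Q_def
        using \<open>E \<sigma> \<noteq> 0\<close> calc_real_commute[OF sa E] by blast
    qed
    ultimately show ?thesis by blast
  qed
  \<comment> \<open>The sign may depend on the tolerance. If each sign failed somewhere, both would
    fail at the smaller tolerance by \<open>mono\<close>, against \<open>or\<close>; the bound
    \<open>?R / 2\<close> keeps that tolerance below \<open>norm c\<close>.\<close>
  have "(\<forall>\<delta>>0. Q 1 \<delta>) \<or> (\<forall>\<delta>>0. Q (-1) \<delta>)"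
  proof (rule ccontr)
    assume "\<not> ?thesis"
    then obtain d e where de: "d > 0" "\<not> Q 1 d" "e > 0" "\<not> Q (-1) e" by blast
    let ?m = "min (min d e) (?R / 2)"
    have "?m \<le> ?R / 2" by simp
    then have "?m < ?R" using R by linarith
    then have "Q 1 ?m \<or> Q (-1) ?m" using de R by (intro or) simp_all
    moreover have "?m \<le> d" "?m \<le> e" by linarith+
    ultimately show False using mono[of 1 ?m d] mono[of "-1" ?m e] de by blast
  qed
  then obtain \<sigma> where "\<sigma> = 1 \<or> \<sigma> = -1" "\<forall>\<delta>>0. Q \<sigma> \<delta>" by blast
  then have "spectral_peak c (of_real (\<sigma> * ?R))" "cmod (of_real (\<sigma> * ?R)) = norm c"
    by (auto simp: spectral_peak_def Q_def)
  then show ?thesis by blast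
qed

text \<open>Applied to \<open>adj d * d\<close> with \<open>d = a - s\<close>, this turns a spectral
  value \<open>s\<close> of a normal \<open>a\<close> into an approximate eigenvalue.\<close>

lemma spectral_peak_zero:
  assumes sa: "selfadjoint c" and ni: "\<not> invertible_elt c"
  shows "spectral_peak c 0"
  unfolding spectral_peak_def
proof (intro allI impI)
  fix \<delta> :: real assume \<delta>: "\<delta> > 0"
  note sb = spectral_bound_selfadjoint[OF sa]
  then have cp: "compact (real_segment c)" by (simp add: spectral_bound_def)
  \<comment> \<open>\<open>x * g x = 1 - \<phi> x\<close>, so \<open>g(c)\<close> would be an inverse of \<open>c\<close> if \<open>\<phi>(c)\<close> vanished.\<close>
  define \<phi> where "\<phi> x = max 0 (1 - x\<^sup>2 / \<delta>\<^sup>2)" for x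
  define g where "g x = x / max (x\<^sup>2) (\<delta>\<^sup>2)" for x
  have pos: "max (x\<^sup>2) (\<delta>\<^sup>2) > 0" for x using \<delta> by (simp add: less_max_iff_disj)
  have "continuous_on UNIV \<phi>" unfolding \<phi>_def[abs_def] using \<delta> by (intro continuous_intros) auto
  then obtain e where e: "calc_rel c (real_segment c) (\<lambda>z. of_real (\<phi> (Re z))) e"
    using calc_real_exists[OF sa] by blast
  have "continuous_on UNIV g" unfolding g_def[abs_def]
    by (intro continuous_intros) (use pos in \<open>auto simp: less_le\<close>)
  then obtain y where y: "calc_rel c (real_segment c) (\<lambda>z. of_real (g (Re z))) y"
    using calc_real_exists[OF sa] by blast
  have "calc_rel c (real_segment c) (\<lambda>z. z * of_real (g (Re z)) + of_real (\<phi> (Re z))) (c * y + e)"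
    by (intro calc_rel_add calc_rel_mult calc_rel_star_poly star_poly.ident y e cp)
  then have "calc_rel c (real_segment c) (\<lambda>_. 1) (c * y + e)"
  proof (rule calc_rel_cong)
    fix z assume "z \<in> real_segment c"
    then obtain x where "z = of_real x" by (auto simp: real_segment_def)
    moreover have "x * g x + \<phi> x = 1"
    proof (cases "x\<^sup>2 \<le> \<delta>\<^sup>2")
      case True
      then show ?thesis using \<delta> by (simp add: g_def \<phi>_def max_def power2_eq_square)
    next
      case False
      then have "x \<noteq> 0" by auto
      then show ?thesis using False \<delta> by (simp add: g_def \<phi>_def max_def power2_eq_square)
    qed
    ultimately show "z * of_real (g (Re z)) + of_real (\<phi> (Re z)) = 1"
      by (simp flip: of_real_add of_real_mult)
  qed
  moreover have "calc_rel c (real_segment c) (\<lambda>_. 1) 1"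
    using calc_rel_star_poly[OF star_poly.const[of c 1]] by simp
  ultimately have one: "c * y + e = 1" using sb by (rule calc_rel_unique)
  have "e \<noteq> 0"
  proof
    assume "e = 0"
    then have "c * y = 1" using one by simp
    moreover have "c * y = y * c" by (rule calc_real_commute[OF sa y]) simp
    ultimately show False using ni by (auto simp: invertible_elt_def)
  qed
  moreover have "approx_eigen \<delta> c (of_real 0) e"
  proof (rule approx_eigen_calc[OF sa e])
    fix x assume "\<phi> x \<noteq> 0"
    then have "x\<^sup>2 / \<delta>\<^sup>2 \<le> 1" by (auto simp: \<phi>_def max_def split: if_splits)
    then have "x\<^sup>2 \<le> \<delta>\<^sup>2" using \<delta> by (simp add: divide_le_eq)
    then show "\<bar>x - 0\<bar> \<le> \<delta>" using \<delta> by (simp add: flip: abs_le_square_iff)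
  qed (use \<delta> in simp)
  ultimately show "\<exists>e. e \<noteq> 0 \<and> approx_eigen \<delta> c 0 e \<and> (\<forall>w. w * c = c * w \<longrightarrow> w * e = e * w)"
    using calc_real_commute[OF sa e] by (intro exI[of _ e]) simp
qed

subsection \<open>Joint approximate eigenvalues\<close>

lemma approx_eigen_cartesian:
  assumes "approx_eigen \<delta> h (of_real s) f" "approx_eigen \<epsilon> k (of_real t) f"
    and sa: "selfadjoint h" "selfadjoint k"
  shows "approx_eigen (\<delta> + \<epsilon>) (h + \<i> *\<^sub>C k) (of_real s + \<i> * of_real t) f"
  unfolding approx_eigen_def
proof (intro allI conjI)
  fix w
  let ?H = "(h - of_real s *\<^sub>C 1) * (f * w)" and ?K = "(k - of_real t *\<^sub>C 1) * (f * w)"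
  have le: "norm (?H + c *\<^sub>C ?K) \<le> (\<delta> + \<epsilon>) * norm (f * w)" if "cmod c = 1" for c
    using norm_triangle_ineq[of ?H "c *\<^sub>C ?K"] approx_eigenD(1)[OF assms(1), of w]
      approx_eigenD(1)[OF assms(2), of w] that by (simp add: norm_scaleC distrib_right)
  have "(h + \<i> *\<^sub>C k - (of_real s + \<i> * of_real t) *\<^sub>C 1) * (f * w) = ?H + \<i> *\<^sub>C ?K"
    by (simp add: scaleC_ring_simps algebra_simps)
  then show "norm ((h + \<i> *\<^sub>C k - (of_real s + \<i> * of_real t) *\<^sub>C 1) * (f * w))
      \<le> (\<delta> + \<epsilon>) * norm (f * w)"
    using le[of \<i>] by simp
  have "(adj (h + \<i> *\<^sub>C k) - cnj (of_real s + \<i> * of_real t) *\<^sub>C 1) * (f * w) = ?H + (-\<i>) *\<^sub>C ?K"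
    using sa by (simp add: adj_simps selfadjoint_def scaleC_ring_simps algebra_simps)
  then show "norm ((adj (h + \<i> *\<^sub>C k) - cnj (of_real s + \<i> * of_real t) *\<^sub>C 1) * (f * w))
      \<le> (\<delta> + \<epsilon>) * norm (f * w)"
    using le[of "-\<i>"] by simp
qed

lemma cartesian_decomposition:
  fixes a :: "'a::unital_cstar_algebra"
  obtains h k where "selfadjoint h" "selfadjoint k" "a = h + \<i> *\<^sub>C k"
    "\<And>w. w * a = a * w \<Longrightarrow> w * adj a = adj a * w \<Longrightarrow> w * h = h * w \<and> w * k = k * w"
proof -
  define h where "h = (1/2) *\<^sub>C (a + adj a)"
  define k where "k = (- \<i>/2) *\<^sub>C (a - adj a)"
  have "selfadjoint h" "selfadjoint k"
    by (simp_all add: selfadjoint_def h_def k_def adj_simps scaleC_ring_simps add.commute)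
  moreover have "h + \<i> *\<^sub>C k = (1/2 + 1/2) *\<^sub>C a"
    unfolding h_def k_def by (simp add: scaleC_ring_simps del: scaleC_one)
      (simp flip: scaleC_add_left)
  then have "a = h + \<i> *\<^sub>C k" by simp
  moreover have "w * h = h * w \<and> w * k = k * w" if "w * a = a * w" "w * adj a = adj a * w" for w
    using that by (simp add: h_def k_def scaleC_ring_simps algebra_simps)
  ultimately show thesis by (rule that)
qed

text \<open>The real and imaginary parts of \<open>a\<close> are localised in turn, the second
  relative to \<open>e * f\<close>. They commute because \<open>a\<close> is normal, so
  \<open>f\<close> and \<open>g\<close> commute and their product is localised for both
  parts.\<close>

lemma exists_approx_eigen_normal:
  assumes na: "normal_element a" and e: "e \<noteq> 0" and \<delta>: "\<delta> > 0"
  obtains s f where "e * f \<noteq> 0" "approx_eigen \<delta> a s f"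
    "\<And>w. w * a = a * w \<Longrightarrow> w * adj a = adj a * w \<Longrightarrow> w * f = f * w"
proof -
  obtain h k where sa: "selfadjoint h" "selfadjoint k" and a: "a = h + \<i> *\<^sub>C k"
    and comm: "\<And>w. w * a = a * w \<Longrightarrow> w * adj a = adj a * w \<Longrightarrow> w * h = h * w \<and> w * k = k * w"
    using cartesian_decomposition by metis
  have "a * adj a = adj a * a" using na by (simp add: normal_element_def)
  then have "h * a = a * h" "h * adj a = adj a * h"
    using comm[of a] comm[of "adj a"] by simp_all
  then have kh: "k * h = h * k" using comm[of h] by simp
  have "\<delta> / 2 > 0" using \<delta> by simp
  obtain s f where f: "e * f \<noteq> 0" "approx_eigen (\<delta> / 2) h (of_real s) f"
      "\<And>w. w * h = h * w \<Longrightarrow> w * f = f * w"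
    using exists_approx_eigen_selfadjoint[OF sa(1) e \<open>\<delta> / 2 > 0\<close>] by metis
  obtain t g where g: "e * f * g \<noteq> 0" "approx_eigen (\<delta> / 2) k (of_real t) g"
      "\<And>w. w * k = k * w \<Longrightarrow> w * g = g * w"
    using exists_approx_eigen_selfadjoint[OF sa(2) f(1) \<open>\<delta> / 2 > 0\<close>] by metis
  have fg: "f * g = g * f" using g(3)[of f] f(3)[of k] kh by simp
  show thesis
  proof (rule that[of "f * g" "of_real s + \<i> * of_real t"])
    show "e * (f * g) \<noteq> 0" using g(1) by (simp add: mult.assoc)
    have "approx_eigen (\<delta> / 2) k (of_real t) (f * g)"
      unfolding fg by (rule approx_eigen_mult[OF g(2)])
    from approx_eigen_cartesian[OF approx_eigen_mult[OF f(2)] this sa]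
    show "approx_eigen \<delta> a (of_real s + \<i> * of_real t) (f * g)" by (simp flip: a)
    show "w * (f * g) = f * g * w" if "w * a = a * w" "w * adj a = adj a * w" for w
    proof -
      have "w * (f * g) = f * (w * g)" using f(3)[OF comm[OF that, THEN conjunct1]] by (simp flip: mult.assoc)
      then show ?thesis using g(3)[OF comm[OF that, THEN conjunct2]] by (simp add: mult.assoc)
    qed
  qed
qed

text \<open>For a finite family of commuting normal elements this describes the joint spectrum: one
  localiser must serve all members of \<open>L\<close> at once.\<close>

definition joint_eigen :: "('a::unital_cstar_algebra \<times> complex) set \<Rightarrow> bool"
  where "joint_eigen L \<longleftrightarrow> (\<forall>\<delta>>0. \<exists>e. e \<noteq> 0 \<and> (\<forall>(a, s)\<in>L. approx_eigen \<delta> a s e))"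

lemma joint_eigen_subset: "joint_eigen L \<Longrightarrow> L' \<subseteq> L \<Longrightarrow> joint_eigen L'"
  unfolding joint_eigen_def by (meson subsetD)

text \<open>The value \<open>l\<close> at \<open>c\<close> is prescribed; those at \<open>a\<close>
  and \<open>b\<close> come from successive localisation and depend on the tolerance. They stay
  bounded, so a subsequence converges, and its limit serves every tolerance.\<close>

lemma joint_eigen_exists:
  assumes c: "spectral_peak c l" and na: "normal_element a" and nb: "normal_element b"
    and ac: "a * c = c * a" "adj a * c = c * adj a"
    and bc: "b * c = c * b" "adj b * c = c * adj b"
    and ba: "b * a = a * b" "b * adj a = adj a * b"
  shows "\<exists>s p. joint_eigen {(c, l), (a, s), (b, p)}"
proof -
  have ab: "a * adj b = adj b * a" "adj a * adj b = adj b * adj a"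
    using arg_cong[OF ba(2), of adj] arg_cong[OF ba(1), of adj] by (simp_all add: adj_simps)
  have "\<exists>s p e. e \<noteq> 0 \<and> approx_eigen \<delta> c l e \<and> approx_eigen \<delta> a s e \<and> approx_eigen \<delta> b p e"
    if \<delta>: "\<delta> > 0" for \<delta>
  proof -
    obtain e where e: "e \<noteq> 0" "approx_eigen \<delta> c l e" "\<And>w. w * c = c * w \<Longrightarrow> w * e = e * w"
      using c \<delta> unfolding spectral_peak_def by metis
    obtain s f where f: "e * f \<noteq> 0" "approx_eigen \<delta> a s f"
        "\<And>w. w * a = a * w \<Longrightarrow> w * adj a = adj a * w \<Longrightarrow> w * f = f * w"
      using exists_approx_eigen_normal[OF na e(1) \<delta>] by metis
    obtain p g where g: "e * f * g \<noteq> 0" "approx_eigen \<delta> b p g"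
        "\<And>w. w * b = b * w \<Longrightarrow> w * adj b = adj b * w \<Longrightarrow> w * g = g * w"
      using exists_approx_eigen_normal[OF nb f(1) \<delta>] by metis
    \<comment> \<open>Localisation is inherited from the leftmost factor; the commutations shown
      here move each of the three localisers to that place.\<close>
    have ef: "e * f = f * e"
      using f(3)[of e] e(3)[OF ac(1)] e(3)[OF ac(2)] by simp
    have comm: "x * (e * f) = e * f * x" if "x * e = e * x" "x * f = f * x" for x
      by (metis that mult.assoc)
    have "b * (e * f) = e * f * b"
      by (intro comm e(3) f(3) bc ba)
    moreover have "adj b * (e * f) = e * f * adj b"
      by (intro comm e(3) f(3) bc ab[symmetric])
    ultimately have efg: "e * f * g = g * (e * f)"
      using g(3)[of "e * f"] by simp
    have "approx_eigen \<delta> c l (e * f * g)"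
      unfolding mult.assoc by (rule approx_eigen_mult[OF e(2)])
    moreover have "approx_eigen \<delta> a s (e * f * g)"
      unfolding ef mult.assoc by (rule approx_eigen_mult[OF f(2)])
    moreover have "approx_eigen \<delta> b p (e * f * g)"
      unfolding efg by (rule approx_eigen_mult[OF g(2)])
    ultimately show ?thesis using g(1) by blast
  qed
  then have "\<forall>n. \<exists>s p e. e \<noteq> 0 \<and> approx_eigen (1 / Suc n) c l e \<and> approx_eigen (1 / Suc n) a s e \<and>
      approx_eigen (1 / Suc n) b p e"
    by simp
  then obtain s p e where e: "\<And>n. e n \<noteq> 0" "\<And>n. approx_eigen (1 / Suc n) c l (e n)"
      "\<And>n. approx_eigen (1 / Suc n) a (s n) (e n)" "\<And>n. approx_eigen (1 / Suc n) b (p n) (e n)"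
    by metis
  have "norm (s n, p n) \<le> norm a + 1 + (norm b + 1)" for n
  proof -
    have "1 / real (Suc n) \<le> 1" by simp
    then have "cmod (s n) \<le> norm a + 1" "cmod (p n) \<le> norm b + 1"
      using approx_eigen_bound[OF e(3,1), of n] approx_eigen_bound[OF e(4,1), of n] by linarith+
    then show ?thesis using norm_Pair_le[of "s n" "p n"] by linarith
  qed
  then have "bounded (range (\<lambda>n. (s n, p n)))" by (auto simp: bounded_iff)
  then obtain x r where r: "strict_mono r" and lim: "((\<lambda>n. (s n, p n)) \<circ> r) \<longlonglongrightarrow> x"
    using bounded_imp_convergent_subsequence by blast
  obtain s' p' where x: "x = (s', p')" by (cases x)
  have s: "(\<lambda>n. s (r n)) \<longlonglongrightarrow> s'" and p: "(\<lambda>n. p (r n)) \<longlonglongrightarrow> p'"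
    using tendsto_fst[OF lim] tendsto_snd[OF lim] by (simp_all add: x o_def)
  have inv: "(\<lambda>n. 1 / real (Suc (r n))) \<longlonglongrightarrow> 0"
    using LIMSEQ_subseq_LIMSEQ[OF LIMSEQ_inverse_real_of_nat r] by (simp add: o_def inverse_eq_divide)
  have "joint_eigen {(c, l), (a, s'), (b, p')}"
    unfolding joint_eigen_def
  proof (intro allI impI)
    fix \<delta> :: real assume \<delta>: "\<delta> > 0"
    have "(\<lambda>n. 1 / real (Suc (r n)) + (cmod (s (r n) - s') + cmod (p (r n) - p'))) \<longlonglongrightarrow>
        0 + (cmod (s' - s') + cmod (p' - p'))"
      by (intro tendsto_intros inv s p)
    then have "\<forall>\<^sub>F n in sequentially.
        1 / real (Suc (r n)) + (cmod (s (r n) - s') + cmod (p (r n) - p')) < \<delta>"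
      using \<delta> by (intro order_tendstoD) auto
    then obtain n where n: "1 / real (Suc (r n)) + (cmod (s (r n) - s') + cmod (p (r n) - p')) < \<delta>"
      by (auto simp: eventually_sequentially)
    have "approx_eigen \<delta> c l (e (r n))"
      by (rule approx_eigen_mono[OF e(2)[of "r n"]]) (use n norm_ge_zero in \<open>smt (verit)\<close>)
    moreover have "approx_eigen \<delta> a s' (e (r n))"
      by (rule approx_eigen_mono[OF approx_eigen_shift[OF e(3)[of "r n"]]])
        (use n norm_ge_zero in \<open>smt (verit)\<close>)
    moreover have "approx_eigen \<delta> b p' (e (r n))"
      by (rule approx_eigen_mono[OF approx_eigen_shift[OF e(4)[of "r n"]]])
        (use n norm_ge_zero in \<open>smt (verit)\<close>)
    ultimately show "\<exists>e. e \<noteq> 0 \<and> (\<forall>(a, s)\<in>{(c, l), (a, s'), (b, p')}. approx_eigen \<delta> a s e)"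
      using e(1) by (intro exI[of _ "e (r n)"]) simp
  qed
  then show ?thesis by blast
qed

text \<open>Elements of norm 1 act as approximate eigenvectors for left multiplication. Along a
  fixed \<open>v\<close> eigenvalues are unique, additive and multiplicative, so \<open>v\<close>
  evaluates expressions as a character would.\<close>

definition eigen_seq :: "(nat \<Rightarrow> 'a) \<Rightarrow> 'a::unital_cstar_algebra \<Rightarrow> complex \<Rightarrow> bool"
  where "eigen_seq v a s \<longleftrightarrow> (\<forall>n. norm (v n) = 1) \<and> (\<lambda>n. (a - s *\<^sub>C 1) * v n) \<longlonglongrightarrow> 0"

lemma joint_eigen_seq:
  assumes "joint_eigen L"
  shows "\<exists>v. \<forall>(a, s)\<in>L. eigen_seq v a s \<and> eigen_seq v (adj a) (cnj s)"
proof -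
  have "\<forall>n. \<exists>e. e \<noteq> 0 \<and> (\<forall>(a, s)\<in>L. approx_eigen (1 / real (Suc n)) a s e)"
    using assms unfolding joint_eigen_def by simp
  then obtain e where e: "\<And>n. e n \<noteq> 0"
      "\<And>n. \<forall>(a, s)\<in>L. approx_eigen (1 / real (Suc n)) a s (e n)"
    by metis
  define v where "v n = e n * (inverse (norm (e n)) *\<^sub>R 1)" for n
  have v1: "norm (v n) = 1" for n using e(1) by (simp add: v_def)
  have inv: "(\<lambda>n. 1 / real (Suc n)) \<longlonglongrightarrow> 0"
    using LIMSEQ_inverse_real_of_nat by (simp add: inverse_eq_divide)
  have "eigen_seq v a s \<and> eigen_seq v (adj a) (cnj s)" if "(a, s) \<in> L" for a s
  proof -
    have ae: "approx_eigen (1 / real (Suc n)) a s (e n)" for n using e(2) that by blast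
    have "norm ((a - s *\<^sub>C 1) * v n) \<le> 1 / real (Suc n)"
      "norm ((adj a - cnj s *\<^sub>C 1) * v n) \<le> 1 / real (Suc n)" for n
      using approx_eigenD[OF ae, of n "inverse (norm (e n)) *\<^sub>R 1"] v1[of n]
      by (simp_all only: v_def mult_1_right)
    then show ?thesis unfolding eigen_seq_def
      using v1 by (auto intro!: Lim_null_comparison[OF always_eventually inv])
  qed
  then show ?thesis by blast
qed

lemma eigen_seq_unique:
  assumes "eigen_seq v x s" "eigen_seq v x t"
  shows "s = t"
proof -
  have "(\<lambda>n. (x - t *\<^sub>C 1) * v n - (x - s *\<^sub>C 1) * v n) \<longlonglongrightarrow> 0 - 0"
    using assms unfolding eigen_seq_def by (intro tendsto_diff) auto
  also have "(\<lambda>n. (x - t *\<^sub>C 1) * v n - (x - s *\<^sub>C 1) * v n) = (\<lambda>n. (s - t) *\<^sub>C v n)"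
    by (simp add: scaleC_ring_simps algebra_simps)
  finally have "(\<lambda>n. norm ((s - t) *\<^sub>C v n)) \<longlonglongrightarrow> 0" by (simp add: tendsto_norm_zero)
  then have "(\<lambda>n. cmod (s - t)) \<longlonglongrightarrow> 0"
    using assms by (simp add: norm_scaleC eigen_seq_def)
  then show ?thesis by (simp add: LIMSEQ_const_iff)
qed

lemma eigen_seq_spectrum:
  assumes "eigen_seq v x s"
  shows "s \<in> spectrum x"
proof (rule ccontr)
  assume "s \<notin> spectrum x"
  then have inv: "invertible_elt (x - s *\<^sub>C 1)" by (simp add: in_spectrum_iff)
  let ?y = "inv_elt (x - s *\<^sub>C 1)"
  have "(\<lambda>n. ?y * ((x - s *\<^sub>C 1) * v n)) \<longlonglongrightarrow> ?y * 0"
    using assms unfolding eigen_seq_def by (intro tendsto_intros) auto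
  also have "(\<lambda>n. ?y * ((x - s *\<^sub>C 1) * v n)) = v"
    using inv_elt(2)[OF inv] by (simp flip: mult.assoc)
  finally have "(\<lambda>n. norm (v n)) \<longlonglongrightarrow> 0" by (simp add: tendsto_norm_zero)
  then show False using assms by (simp add: eigen_seq_def LIMSEQ_const_iff)
qed

lemma eigen_seq_add:
  assumes "eigen_seq v x s" "eigen_seq v y t"
  shows "eigen_seq v (x + y) (s + t)"
proof -
  have "(\<lambda>n. (x - s *\<^sub>C 1) * v n + (y - t *\<^sub>C 1) * v n) \<longlonglongrightarrow> 0 + 0"
    using assms unfolding eigen_seq_def by (intro tendsto_add) auto
  also have "(\<lambda>n. (x - s *\<^sub>C 1) * v n + (y - t *\<^sub>C 1) * v n) = (\<lambda>n. (x + y - (s + t) *\<^sub>C 1) * v n)"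
    by (simp add: scaleC_ring_simps algebra_simps)
  finally show ?thesis using assms by (simp add: eigen_seq_def)
qed

lemma eigen_seq_mult:
  assumes "eigen_seq v x s" "eigen_seq v y t"
  shows "eigen_seq v (x * y) (s * t)"
proof -
  have "(\<lambda>n. x * ((y - t *\<^sub>C 1) * v n) + t *\<^sub>C ((x - s *\<^sub>C 1) * v n)) \<longlonglongrightarrow> x * 0 + t *\<^sub>C 0"
    using assms unfolding eigen_seq_def by (intro tendsto_intros tendsto_scaleC) auto
  also have "(\<lambda>n. x * ((y - t *\<^sub>C 1) * v n) + t *\<^sub>C ((x - s *\<^sub>C 1) * v n)) =
      (\<lambda>n. (x * y - (s * t) *\<^sub>C 1) * v n)"
    by (simp add: scaleC_ring_simps algebra_simps)
  finally show ?thesis using assms by (simp add: eigen_seq_def)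
qed

lemma eigen_seq_star_poly:
  assumes "star_poly a f x" and v: "eigen_seq v a s" "eigen_seq v (adj a) (cnj s)"
  shows "eigen_seq v x (f s)"
  using assms(1)
proof induction
  case (const c)
  then show ?case using v by (simp add: eigen_seq_def)
qed (use v in \<open>auto intro: eigen_seq_add eigen_seq_mult\<close>)

text \<open>Replacing \<open>x\<close> and \<open>f s\<close> by an approximating star-polynomial
  and its value at \<open>s\<close> costs less than two thirds of \<open>e\<close> for all
  \<open>n\<close>, since \<open>norm (v n) = 1\<close>; the last third is the case of that
  star-polynomial.\<close>

lemma eigen_seq_calc:
  assumes x: "calc_rel a K f x" and s: "s \<in> K" and v: "eigen_seq v a s" "eigen_seq v (adj a) (cnj s)"
  shows "eigen_seq v x (f s)"
  unfolding eigen_seq_def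
proof (intro conjI allI)
  show v1: "norm (v n) = 1" for n using v by (simp add: eigen_seq_def)
  obtain g y where g: "\<And>n. star_poly a (g n) (y n)" "uniform_limit K g f sequentially" "y \<longlonglongrightarrow> x"
    using x by (auto simp: calc_rel_def)
  show "(\<lambda>n. (x - f s *\<^sub>C 1) * v n) \<longlonglongrightarrow> 0"
  proof (rule LIMSEQ_I)
    fix e :: real assume e: "e > 0"
    have "\<forall>\<^sub>F n in sequentially. dist (y n) x < e / 3 \<and> dist (g n s) (f s) < e / 3"
      using tendstoD[OF g(3), of "e / 3"] tendstoD[OF tendsto_uniform_limitI[OF g(2) s], of "e / 3"] e
      by (intro eventually_conj) auto
    then obtain N where N: "norm (y N - x) < e / 3" "cmod (g N s - f s) < e / 3"
      by (auto simp: eventually_sequentially dist_norm)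
    have "(\<lambda>n. (y N - g N s *\<^sub>C 1) * v n) \<longlonglongrightarrow> 0"
      using eigen_seq_star_poly[OF g(1) v] by (simp add: eigen_seq_def)
    then obtain M where M: "\<And>n. n \<ge> M \<Longrightarrow> norm ((y N - g N s *\<^sub>C 1) * v n) < e / 3"
      using LIMSEQ_D[of _ 0 "e / 3"] e by (metis diff_zero divide_pos_pos zero_less_numeral)
    have "norm ((x - f s *\<^sub>C 1) * v n - 0) < e" if "n \<ge> M" for n
    proof -
      have "(x - f s *\<^sub>C 1) * v n =
          ((g N s - f s) *\<^sub>C v n - (y N - x) * v n) + (y N - g N s *\<^sub>C 1) * v n"
        by (simp add: scaleC_ring_simps algebra_simps)
      moreover have "norm ((g N s - f s) *\<^sub>C v n) < e / 3" "norm ((y N - x) * v n) < e / 3"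
        using N norm_mult_ineq[of "y N - x" "v n"] v1[of n] by (simp_all add: norm_scaleC)
      ultimately show ?thesis
        using M[OF that] norm_triangle_ineq[of "(g N s - f s) *\<^sub>C v n - (y N - x) * v n"
            "(y N - g N s *\<^sub>C 1) * v n"]
          norm_triangle_ineq4[of "(g N s - f s) *\<^sub>C v n" "(y N - x) * v n"]
        by simp
    qed
    then show "\<exists>no. \<forall>n\<ge>no. norm ((x - f s *\<^sub>C 1) * v n - 0) < e" by blast
  qed
qed

lemma eigen_seq_norm_le:
  assumes "eigen_seq v x s"
  shows "cmod s \<le> norm x"
  by (rule spectrum_norm_le[OF eigen_seq_spectrum[OF assms]])

text \<open>A peak \<open>l\<close> of \<open>adj x * x\<close> has modulus equal to its norm, and
  along an approximate eigenvector with value \<open>s\<close> at \<open>a\<close> it equals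
  \<open>cnj (f s) * f s\<close>. This yields the norm bound on the spectrum itself and, for
  \<open>f z = z\<close>, a point of the spectrum.\<close>

lemma star_poly_norm_attained:
  assumes na: "normal_element a" and f: "star_poly a f x"
  shows "\<exists>s\<in>spectrum a. norm x = cmod (f s)"
proof -
  let ?c = "adj x * x"
  have c: "star_poly a (\<lambda>z. cnj (f z) * f z) ?c"
    by (intro star_poly.mult star_poly_adj f)
  have aa: "a * adj a = adj a * a" using na by (simp add: normal_element_def)
  have ac: "a * ?c = ?c * a" "adj a * ?c = ?c * adj a"
    by (rule star_poly_commute[OF c]; simp add: aa)+
  have "selfadjoint ?c" by (simp add: selfadjoint_def adj_mult adj_adj)
  then obtain l where l: "cmod l = norm ?c" "spectral_peak ?c l" using spectral_peak_norm by blast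
  obtain s p where "joint_eigen {(?c, l), (a, s), (a, p)}"
    using joint_eigen_exists[OF l(2) na na ac ac refl aa] by blast
  from joint_eigen_seq[OF this] obtain v where
    v: "eigen_seq v ?c l" "eigen_seq v a s" "eigen_seq v (adj a) (cnj s)" by auto
  have "l = cnj (f s) * f s"
    using eigen_seq_unique[OF v(1) eigen_seq_star_poly[OF c v(2,3)]] .
  then have "(norm x)\<^sup>2 = (cmod (f s))\<^sup>2"
    using l(1) by (simp add: cstar_identity norm_mult power2_eq_square)
  then have "norm x = cmod (f s)" by simp
  then show ?thesis using eigen_seq_spectrum[OF v(2)] by blast
qed

lemma spectrum_nonempty: "normal_element a \<Longrightarrow> spectrum a \<noteq> {}"
  using star_poly_norm_attained[OF _ star_poly.ident] by blast

lemma spectral_bound_normal: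
  assumes "normal_element a"
  shows "spectral_bound a (spectrum a)"
  unfolding spectral_bound_def
proof (intro conjI allI impI)
  fix f x m assume "star_poly a f x" and "\<forall>z\<in>spectrum a. cmod (f z) \<le> m"
  with star_poly_norm_attained[OF assms] show "norm x \<le> m" by fastforce
qed (rule compact_spectrum)

text \<open>With \<open>d = a - s\<close>, the element \<open>adj d * d\<close> has 0 as a peak. A
  joint approximate eigenvalue \<open>(0, t, p)\<close> then satisfies
  \<open>cnj (t - s) * (t - s) = 0\<close>, so \<open>t = s\<close> and \<open>p\<close> is a value
  over \<open>s\<close>.\<close>

lemma spectrum_joint_eigen:
  assumes s: "s \<in> spectrum a" and na: "normal_element a" and nb: "normal_element b"
    and ba: "b * a = a * b" "b * adj a = adj a * b"
  shows "\<exists>p. joint_eigen {(a, s), (b, p)}"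
proof -
  let ?d = "a - s *\<^sub>C 1"
  let ?T = "adj ?d * ?d"
  have aa: "a * adj a = adj a * a" using na by (simp add: normal_element_def)
  have ab: "a * adj b = adj b * a" "adj a * adj b = adj b * adj a"
    using arg_cong[OF ba(2), of adj] arg_cong[OF ba(1), of adj] by (simp_all add: adj_simps)
  have dd: "?d * adj ?d = ?T"
    by (simp add: adj_simps scaleC_ring_simps algebra_simps aa)
  have T: "star_poly a (\<lambda>z. cnj (z - s) * (z - s)) ?T"
    by (intro star_poly.mult star_poly_adj[where f = "\<lambda>z. z - s"] star_poly_diff star_poly.ident star_poly.const)
  have "\<not> invertible_elt ?T"
  proof
    assume inv: "invertible_elt ?T"
    let ?y = "inv_elt ?T"
    \<comment> \<open>By normality \<open>?T\<close> is also \<open>?d * adj ?d\<close>, so its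
      inverse supplies a left and a right inverse of \<open>?d\<close>.\<close>
    have "?y * adj ?d * ?d = 1" "?d * (adj ?d * ?y) = 1"
      using inv_elt[OF inv] dd by (simp_all only: mult.assoc) (simp only: dd flip: mult.assoc)
    then have "invertible_elt ?d" by (rule invertible_eltI)
    then show False using s by (simp add: in_spectrum_iff)
  qed
  then have peak: "spectral_peak ?T 0"
    by (intro spectral_peak_zero) (simp_all add: selfadjoint_def adj_mult adj_adj)
  have comm: "w * ?T = ?T * w" if "w * a = a * w" "w * adj a = adj a * w" for w
    by (rule star_poly_commute[OF T that])
  have cT: "a * ?T = ?T * a" "adj a * ?T = ?T * adj a" "b * ?T = ?T * b" "adj b * ?T = ?T * adj b"
    by (rule comm; simp only: aa ba ab)+
  obtain t p where tp: "joint_eigen {(?T, 0), (a, t), (b, p)}"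
    using joint_eigen_exists[OF peak na nb cT ba] by blast
  from joint_eigen_seq[OF tp] obtain v where
    v: "eigen_seq v ?T 0" "eigen_seq v a t" "eigen_seq v (adj a) (cnj t)" by auto
  have "cnj (t - s) * (t - s) = 0"
    using eigen_seq_unique[OF eigen_seq_star_poly[OF T v(2,3)] v(1)] .
  then have "t = s" by simp
  then show ?thesis using joint_eigen_subset[OF tp, of "{(a, s), (b, p)}"] by auto
qed

subsection \<open>The functional calculus of a normal element\<close>

text \<open>Approximate eigenvectors of \<open>a\<close> at \<open>s\<close> are approximate
  eigenvectors of \<open>x\<close> at \<open>f s\<close>. Together with
  \<open>calc_rel_norm_le\<close> this makes the calculus isometric.\<close>

lemma calc_rel_norm_ge:
  assumes na: "normal_element a" and f: "calc_rel a (spectrum a) f x" and s: "s \<in> spectrum a"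
  shows "cmod (f s) \<le> norm x"
proof -
  have "adj a * a = a * adj a" using na by (simp add: normal_element_def)
  then obtain p where "joint_eigen {(a, s), (a, p)}"
    using spectrum_joint_eigen[OF s na na] by auto
  from joint_eigen_seq[OF this] obtain v where "eigen_seq v a s" "eigen_seq v (adj a) (cnj s)" by auto
  from eigen_seq_norm_le[OF eigen_seq_calc[OF f s this]] show ?thesis .
qed

lemma is_cont_fun_calculus_star_poly:
  assumes \<Phi>: "is_cont_fun_calculus a \<Phi>" and g: "star_poly a g y"
  shows "\<Phi> g = y"
  using g
proof induction
  case (const c)
  have "\<Phi> (\<lambda>z. c * 1) = c *\<^sub>C \<Phi> (\<lambda>z. 1)"
    using \<Phi> continuous_on_const[of "spectrum a" "1::complex"]
    unfolding is_cont_fun_calculus_def by blast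
  moreover have "\<Phi> (\<lambda>z. 1) = 1" using \<Phi> by (simp add: is_cont_fun_calculus_def)
  ultimately show ?case by simp
next
  case ident
  show ?case using \<Phi> by (simp add: is_cont_fun_calculus_def)
next
  case cnj
  have "\<Phi> (\<lambda>z. cnj z) = adj (\<Phi> (\<lambda>z. z))"
    using \<Phi> continuous_on_id[of "spectrum a"] unfolding is_cont_fun_calculus_def id_def by blast
  moreover have "\<Phi> (\<lambda>z. z) = a" using \<Phi> by (simp add: is_cont_fun_calculus_def)
  ultimately show ?case by simp
next
  case (add f x g y)
  have "\<Phi> (\<lambda>z. f z + g z) = \<Phi> f + \<Phi> g"
    using \<Phi> star_poly_continuous[OF add.hyps(1), of "spectrum a"]
      star_poly_continuous[OF add.hyps(2), of "spectrum a"]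
    unfolding is_cont_fun_calculus_def by blast
  with add.IH show ?case by simp
next
  case (mult f x g y)
  have "\<Phi> (\<lambda>z. f z * g z) = \<Phi> f * \<Phi> g"
    using \<Phi> star_poly_continuous[OF mult.hyps(1), of "spectrum a"]
      star_poly_continuous[OF mult.hyps(2), of "spectrum a"]
    unfolding is_cont_fun_calculus_def by blast
  with mult.IH show ?case by simp
qed

text \<open>The values of \<open>\<Phi>\<close> on star-polynomials are forced, its isometry makes
  it continuous, and density leaves no further choice. This is the uniqueness behind the
  \<open>THE\<close> in \<open>cont_fun_calculus\<close>.\<close>

lemma is_cont_fun_calculus_calc_rel:
  assumes na: "normal_element a" and \<Phi>: "is_cont_fun_calculus a \<Phi>"
    and f: "continuous_on (spectrum a) f"
  shows "calc_rel a (spectrum a) f (\<Phi> f)"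
proof -
  obtain x where "calc_rel a (spectrum a) f x"
    using calc_rel_exists[OF spectral_bound_normal[OF na] f] by blast
  then obtain g y where g: "\<And>n. star_poly a (g n) (y n)" "uniform_limit (spectrum a) g f sequentially"
    by (auto simp: calc_rel_def)
  have "y \<longlonglongrightarrow> \<Phi> f"
  proof (rule tendstoI)
    fix e :: real assume e: "e > 0"
    then have "e / 2 > 0" by simp
    from uniform_limitD[OF g(2) this]
    show "\<forall>\<^sub>F n in sequentially. dist (y n) (\<Phi> f) < e"
    proof eventually_elim
      case (elim n)
      \<comment> \<open>The difference has this shape because \<open>is_cont_fun_calculus\<close>
        speaks of sums and scalar multiples.\<close>
      let ?d = "\<lambda>z. f z + (-1) * g n z"
      note cg = star_poly_continuous[OF g(1)[of n], of "spectrum a"]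
      have c1: "continuous_on (spectrum a) (\<lambda>z. (-1) * g n z)"
        by (intro continuous_intros cg)
      have cd: "continuous_on (spectrum a) ?d"
        by (intro continuous_intros f cg)
      have "\<Phi> ?d = \<Phi> f + \<Phi> (\<lambda>z. (-1) * g n z)"
        using \<Phi> f c1 unfolding is_cont_fun_calculus_def by blast
      moreover have "\<Phi> (\<lambda>z. (-1) * g n z) = (-1) *\<^sub>C \<Phi> (g n)"
        using \<Phi> cg unfolding is_cont_fun_calculus_def by blast
      ultimately have "\<Phi> ?d = \<Phi> f - y n"
        by (simp add: is_cont_fun_calculus_star_poly[OF \<Phi> g(1)] scaleC_minus_left)
      moreover have "norm (\<Phi> ?d) = (SUP z\<in>spectrum a. cmod (?d z))"
        using \<Phi> cd unfolding is_cont_fun_calculus_def by blast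
      moreover have "(SUP z\<in>spectrum a. cmod (?d z)) \<le> e / 2"
        by (rule cSUP_least[OF spectrum_nonempty[OF na]])
          (use elim in \<open>auto simp: dist_norm norm_minus_commute less_imp_le\<close>)
      ultimately show ?case using e by (simp add: dist_norm norm_minus_commute)
    qed
  qed
  with g show ?thesis unfolding calc_rel_def by blast
qed

lemma is_cont_fun_calculus_exists:
  assumes na: "normal_element a"
  shows "\<exists>\<Phi>. is_cont_fun_calculus a \<Phi>"
proof -
  define \<Phi> where "\<Phi> f =
    (if continuous_on (spectrum a) f then THE x. calc_rel a (spectrum a) f x else 0)" for f
  let ?S = "spectrum a"
  note sb = spectral_bound_normal[OF na]
  have eq: "\<Phi> f = x" if "calc_rel a ?S f x" for f x
  proof -
    have "(THE x. calc_rel a ?S f x) = x"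
      by (rule the_equality[where P = "calc_rel a ?S f", OF that]) (rule calc_rel_unique[OF _ that sb])
    then show ?thesis using calc_rel_continuous[OF that] by (simp add: \<Phi>_def)
  qed
  have rel: "calc_rel a ?S f (\<Phi> f)" if "continuous_on ?S f" for f
    using calc_rel_exists[OF sb that] eq by metis
  note poly = eq[OF calc_rel_star_poly]
  have "norm (\<Phi> f) = (SUP z\<in>?S. cmod (f z))" if f: "continuous_on ?S f" for f
  proof (rule antisym)
    have "bdd_above ((\<lambda>z. cmod (f z)) ` ?S)"
      by (intro bounded_imp_bdd_above compact_imp_bounded compact_continuous_image
          continuous_intros f compact_spectrum)
    then show "norm (\<Phi> f) \<le> (SUP z\<in>?S. cmod (f z))"
      by (intro calc_rel_norm_le[OF rel[OF f] sb] cSUP_upper)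
    show "(SUP z\<in>?S. cmod (f z)) \<le> norm (\<Phi> f)"
      by (intro cSUP_least spectrum_nonempty[OF na] calc_rel_norm_ge[OF na rel[OF f]])
  qed
  moreover have "\<Phi> (\<lambda>z. 1) = 1" using poly[OF star_poly.const[of a 1]] by simp
  moreover have "\<Phi> (\<lambda>z. z) = a" by (rule poly[OF star_poly.ident])
  moreover have "\<Phi> (\<lambda>z. f z + g z) = \<Phi> f + \<Phi> g" "\<Phi> (\<lambda>z. f z * g z) = \<Phi> f * \<Phi> g"
    if "continuous_on ?S f" "continuous_on ?S g" for f g
    by (rule eq, intro calc_rel_add calc_rel_mult rel that compact_spectrum)+
  moreover have "\<Phi> (\<lambda>z. c * f z) = c *\<^sub>C \<Phi> f" "\<Phi> (\<lambda>z. cnj (f z)) = adj (\<Phi> f)"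
    if "continuous_on ?S f" for c f
    by (rule eq, intro calc_rel_scaleC calc_rel_adj rel that compact_spectrum)+
  moreover have "\<Phi> f = \<Phi> g" if "continuous_on ?S f" "\<forall>z\<in>?S. f z = g z" for f g
    using eq[OF calc_rel_cong[OF rel[OF that(1)]]] that(2) by metis
  moreover have "\<Phi> f = 0" if "\<not> continuous_on ?S f" for f using that by (simp add: \<Phi>_def)
  ultimately have "is_cont_fun_calculus a \<Phi>" unfolding is_cont_fun_calculus_def by blast
  then show ?thesis by blast
qed

lemma cont_fun_calculus_eq:
  assumes na: "normal_element a" and x: "calc_rel a (spectrum a) f x"
  shows "cont_fun_calculus a f = x"
proof -
  obtain \<Phi>0 where ex: "is_cont_fun_calculus a \<Phi>0"
    using is_cont_fun_calculus_exists[OF na] by blast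
  have uniq: "\<Psi> = \<Phi>" if "is_cont_fun_calculus a \<Phi>" "is_cont_fun_calculus a \<Psi>" for \<Phi> \<Psi>
  proof
    fix g
    show "\<Psi> g = \<Phi> g"
    proof (cases "continuous_on (spectrum a) g")
      case True
      have "calc_rel a (spectrum a) g (\<Phi> g)" "calc_rel a (spectrum a) g (\<Psi> g)"
        using is_cont_fun_calculus_calc_rel[OF na _ True] that by blast+
      then show ?thesis
        using calc_rel_unique[OF _ _ spectral_bound_normal[OF na]] by blast
    next
      case False
      then show ?thesis using that by (simp add: is_cont_fun_calculus_def)
    qed
  qed
  have "is_cont_fun_calculus a (cont_fun_calculus a)"
    unfolding cont_fun_calculus_def by (rule theI[where P = "is_cont_fun_calculus a", OF ex]) (rule uniq[OF ex])
  from is_cont_fun_calculus_calc_rel[OF na this calc_rel_continuous[OF x]]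
  show ?thesis using x spectral_bound_normal[OF na] by (rule calc_rel_unique)
qed

subsection \<open>The commutator inequality\<close>

text \<open>Both \<open>a z \<approx> s z\<close> and \<open>z a \<approx> t z\<close>; evaluating \<open>z a z\<close> in two ways shows that \<open>z\<^sup>2\<close> is small.\<close>

lemma corner_estimates:
  assumes e: "approx_eigen \<delta> a s e" and g: "approx_eigen \<delta> a t g" and z: "z = e * y * adj g"
  shows "norm (commutator a (z + adj z) - (s - t) *\<^sub>C (z - adj z)) \<le> 4 * \<delta> * norm z"
    and "cmod (s - t) * norm (z * z) \<le> 2 * \<delta> * (norm z)\<^sup>2"
proof -
  have z1: "z = e * (y * adj g)" and z2: "adj z = g * (adj y * adj e)"
    by (simp_all add: z adj_simps mult.assoc)
  have 1: "norm ((a - s *\<^sub>C 1) * z) \<le> \<delta> * norm z"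
    using approx_eigenD(1)[OF e, of "y * adj g"] unfolding z1 .
  have 2: "norm ((a - t *\<^sub>C 1) * adj z) \<le> \<delta> * norm z"
    using approx_eigenD(1)[OF g, of "adj y * adj e"] by (simp only: z2[symmetric] norm_adj)
  \<comment> \<open>Adjoints of the estimates for \<open>adj a\<close> give those for multiplication
    by \<open>a\<close> from the right.\<close>
  have "norm (adj ((adj a - cnj t *\<^sub>C 1) * adj z)) \<le> \<delta> * norm z"
    using approx_eigenD(2)[OF g, of "adj y * adj e"] by (simp only: z2[symmetric] norm_adj)
  then have 3: "norm (z * (a - t *\<^sub>C 1)) \<le> \<delta> * norm z" by (simp add: adj_simps)
  have "norm (adj ((adj a - cnj s *\<^sub>C 1) * z)) \<le> \<delta> * norm z"
    using approx_eigenD(2)[OF e, of "y * adj g"] unfolding norm_adj z1 .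
  then have 4: "norm (adj z * (a - s *\<^sub>C 1)) \<le> \<delta> * norm z" by (simp add: adj_simps)
  have "commutator a (z + adj z) - (s - t) *\<^sub>C (z - adj z) =
      ((a - s *\<^sub>C 1) * z + (a - t *\<^sub>C 1) * adj z) - (z * (a - t *\<^sub>C 1) + adj z * (a - s *\<^sub>C 1))"
    by (simp add: commutator_def scaleC_ring_simps algebra_simps)
  also have "norm \<dots> \<le> (\<delta> * norm z + \<delta> * norm z) + (\<delta> * norm z + \<delta> * norm z)"
    by (intro order_trans[OF norm_triangle_ineq4] order_trans[OF norm_triangle_ineq] add_mono 1 2 3 4)
  finally show "norm (commutator a (z + adj z) - (s - t) *\<^sub>C (z - adj z)) \<le> 4 * \<delta> * norm z"
    by simp
  have "(s - t) *\<^sub>C (z * z) = z * (a - t *\<^sub>C 1) * z - z * ((a - s *\<^sub>C 1) * z)"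
    by (simp add: scaleC_ring_simps algebra_simps)
  then have "cmod (s - t) * norm (z * z) = norm (z * (a - t *\<^sub>C 1) * z - z * ((a - s *\<^sub>C 1) * z))"
    by (metis norm_scaleC)
  also have "\<dots> \<le> (\<delta> * norm z) * norm z + norm z * (\<delta> * norm z)"
    by (intro order_trans[OF norm_triangle_ineq4] add_mono order_trans[OF norm_mult_ineq]
        mult_right_mono mult_left_mono 1 3 norm_ge_zero)
  finally show "cmod (s - t) * norm (z * z) \<le> 2 * \<delta> * (norm z)\<^sup>2"
    by (simp add: power2_eq_square)
qed

text \<open>The case \<open>s = t\<close> is included and says \<open>p = q\<close>: over each
  \<open>s\<close> there is at most one joint approximate eigenvalue.\<close>

lemma joint_eigen_lipschitz:
  fixes a b :: "'a::prime_cstar_algebra"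
  assumes M: "M > 0"
    and ineq: "\<And>x. selfadjoint x \<Longrightarrow> norm (commutator b x) \<le> M * norm (commutator a x)"
    and sp: "joint_eigen {(a, s), (b, p)}" and tq: "joint_eigen {(a, t), (b, q)}"
  shows "cmod (p - q) \<le> M * cmod (s - t)"
proof (cases "s = t \<and> p = q")
  case False
  \<comment> \<open>One of the two differences is positive, and either one makes
    \<open>norm (z * z)\<close> small through its own corner estimate; this covers
    \<open>s = t\<close> as well. The tolerance \<open>\<kappa> / 4\<close> is what gives
    \<open>norm (z * z) \<le> (norm z)\<^sup>2 / 2\<close>.\<close>
  define \<kappa> where "\<kappa> = max (cmod (s - t)) (cmod (p - q))"
  have \<kappa>: "\<kappa> > 0" using False by (auto simp: \<kappa>_def less_max_iff_disj)
  have main: "cmod (p - q) - M * cmod (s - t) \<le> 8 * \<delta> * (1 + M)" if \<delta>: "0 < \<delta>" "\<delta> \<le> \<kappa> / 4" for \<delta>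
  proof -
    obtain e where e: "e \<noteq> 0" "approx_eigen \<delta> a s e" "approx_eigen \<delta> b p e"
      using sp \<delta>(1) unfolding joint_eigen_def by auto
    obtain g where g: "g \<noteq> 0" "approx_eigen \<delta> a t g" "approx_eigen \<delta> b q g"
      using tq \<delta>(1) unfolding joint_eigen_def by auto
    have "adj g \<noteq> 0" using g(1) norm_adj[of g] by (metis norm_eq_zero)
    then obtain y where y: "e * y * adj g \<noteq> 0"
      using prime_cstar[of e "adj g"] e(1) by blast
    define z where "z = e * y * adj g"
    define D where "D = norm (z - adj z)"
    have N: "norm z > 0" using y by (simp add: z_def)
    note A = corner_estimates[OF e(2) g(2) z_def] and B = corner_estimates[OF e(3) g(3) z_def]
    have "\<kappa> * norm (z * z) \<le> 2 * \<delta> * (norm z)\<^sup>2"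
      using A(2) B(2) by (simp add: \<kappa>_def max_def)
    also have "\<dots> \<le> 2 * (\<kappa> / 4) * (norm z)\<^sup>2"
      using \<delta> by (intro mult_right_mono mult_left_mono) auto
    finally have sq: "norm (z * z) \<le> (norm z)\<^sup>2 / 2" using \<kappa> by simp
    \<comment> \<open>As \<open>z\<^sup>2\<close> is small, \<open>z - adj z\<close> has norm at least half that of \<open>z\<close>
      and can be divided out, which keeps the constant \<open>M\<close> exact.\<close>
    have "(norm z)\<^sup>2 = norm (adj z * (z - adj z) + adj (z * z))"
      by (simp add: adj_mult algebra_simps flip: cstar_identity)
    also have "\<dots> \<le> norm z * D + norm (z * z)"
      unfolding D_def
      by (intro order_trans[OF norm_triangle_ineq] add_mono order_trans[OF norm_mult_ineq])
        simp_all
    finally have "norm z * norm z \<le> norm z * (2 * D)"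
      using sq by (simp add: power2_eq_square)
    then have D: "norm z \<le> 2 * D" using N by simp
    with N have D0: "D > 0" by linarith
    have sa: "selfadjoint (z + adj z)" by (simp add: selfadjoint_def adj_simps add.commute)
    have "cmod (p - q) * D = norm ((p - q) *\<^sub>C (z - adj z))" by (simp add: norm_scaleC D_def)
    also have "\<dots> \<le> norm (commutator b (z + adj z)) + 4 * \<delta> * norm z"
      using B(1) norm_triangle_sub[of "(p - q) *\<^sub>C (z - adj z)" "commutator b (z + adj z)"]
      by (simp add: norm_minus_commute)
    also have "\<dots> \<le> M * norm (commutator a (z + adj z)) + 4 * \<delta> * norm z"
      using ineq[OF sa] by simp
    finally have 1: "cmod (p - q) * D \<le> M * norm (commutator a (z + adj z)) + 4 * \<delta> * norm z" .
    have "norm (commutator a (z + adj z)) \<le> cmod (s - t) * D + 4 * \<delta> * norm z"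
      using A(1) norm_triangle_sub[of "commutator a (z + adj z)" "(s - t) *\<^sub>C (z - adj z)"]
      by (simp add: norm_scaleC D_def)
    then have "M * norm (commutator a (z + adj z)) \<le> M * (cmod (s - t) * D + 4 * \<delta> * norm z)"
      using M by (intro mult_left_mono) auto
    with 1 have "(cmod (p - q) - M * cmod (s - t)) * D \<le> 4 * \<delta> * (1 + M) * norm z"
      by (simp add: algebra_simps)
    also have "\<dots> \<le> 4 * \<delta> * (1 + M) * (2 * D)"
      using D \<delta> M by (intro mult_left_mono) auto
    finally have "(cmod (p - q) - M * cmod (s - t)) * D \<le> (8 * \<delta> * (1 + M)) * D"
      by (simp add: mult_ac)
    then show ?thesis using D0 by simp
  qed
  show ?thesis
  proof (rule field_le_epsilon)
    fix \<epsilon> :: real assume \<epsilon>: "\<epsilon> > 0"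
    define \<delta> where "\<delta> = min (\<kappa> / 4) (\<epsilon> / (8 * (1 + M)))"
    have "\<delta> > 0" using \<kappa> \<epsilon> M by (simp add: \<delta>_def)
    moreover have "\<delta> \<le> \<kappa> / 4" unfolding \<delta>_def by (rule min.cobounded1)
    ultimately have "cmod (p - q) - M * cmod (s - t) \<le> 8 * \<delta> * (1 + M)" by (rule main)
    also have "\<dots> \<le> 8 * (\<epsilon> / (8 * (1 + M))) * (1 + M)"
      using M by (intro mult_right_mono mult_left_mono) (auto simp: \<delta>_def)
    also have "\<dots> = \<epsilon>" using M by (simp add: field_simps)
    finally show "cmod (p - q) \<le> M * cmod (s - t) + \<epsilon>" by simp
  qed
qed simp

section \<open>Normality of \<open>b\<close> and its identification with \<open>f(a)\<close>\<close>

lemma commutator_eq_zero_iff: "commutator u v = 0 \<longleftrightarrow> u * v = v * u"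
  by (simp add: commutator_def)

text \<open>A vanishing right-hand side of the commutator inequality gives commutation with
  selfadjoint elements; the Cartesian parts of \<open>c\<close> are such elements and commute with
  \<open>a\<close>. Taking \<open>c\<close> to be \<open>a\<close> and \<open>adj a\<close> prepares
  the choice \<open>adj b\<close>, which shows that \<open>b\<close> is normal.\<close>

lemma commutes_if_selfadjoint_parts:
  fixes b :: "'a::unital_cstar_algebra"
  assumes "\<And>x. selfadjoint x \<Longrightarrow> x * a = a * x \<Longrightarrow> b * x = x * b"
    and "c * a = a * c" "adj c * a = a * adj c"
  shows "b * c = c * b"
proof -
  obtain h k where sa: "selfadjoint h" "selfadjoint k" and c: "c = h + \<i> *\<^sub>C k"
    and comm: "\<And>w. w * c = c * w \<Longrightarrow> w * adj c = adj c * w \<Longrightarrow> w * h = h * w \<and> w * k = k * w"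
    using cartesian_decomposition by metis
  have "h * a = a * h" "k * a = a * k"
    using comm[of a] assms(2,3) by simp_all
  then have "b * h = h * b" "b * k = k * b" using assms(1) sa by blast+
  then show ?thesis by (simp add: c scaleC_ring_simps algebra_simps)
qed

theorem theorem5p2:
  fixes a b :: "'a::prime_cstar_algebra" and M :: real
  assumes "M > 0"
    and "\<And>x. selfadjoint x \<Longrightarrow> norm (commutator b x) \<le> M * norm (commutator a x)"
    and "normal_element a"
  shows "\<exists>f :: complex \<Rightarrow> complex. M-lipschitz_on (spectrum a) f \<and> b = cont_fun_calculus a f"
proof -
  note na = assms(3)
  have aa: "a * adj a = adj a * a" using na by (simp add: normal_element_def)
  have bx: "b * x = x * b" if "selfadjoint x" "x * a = a * x" for x
  proof -
    have "commutator a x = 0" using that by (simp add: commutator_eq_zero_iff)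
    then have "norm (commutator b x) \<le> 0" using assms(2)[OF that(1)] by simp
    then show ?thesis by (simp add: commutator_eq_zero_iff)
  qed
  have ba: "b * a = a * b"
    by (rule commutes_if_selfadjoint_parts[where a = a, OF bx]) (simp_all add: aa)
  have baa: "b * adj a = adj a * b"
    by (rule commutes_if_selfadjoint_parts[where a = a, OF bx]) (simp_all add: aa adj_adj)
  have ab: "a * adj b = adj b * a"
    using arg_cong[OF baa, of adj] by (simp add: adj_simps)
  have aab: "adj a * adj b = adj b * adj a"
    using arg_cong[OF ba, of adj] by (simp add: adj_simps)
  have "b * adj b = adj b * b"
    by (rule commutes_if_selfadjoint_parts[where a = a, OF bx]) (simp_all add: ab ba adj_adj)
  then have nb: "normal_element b" by (simp add: normal_element_def)
  \<comment> \<open>Off the spectrum the value is arbitrary; over a spectral point it exists by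
    \<open>spectrum_joint_eigen\<close> and is unique by \<open>lip\<close>.\<close>
  define f where "f s = (SOME p. joint_eigen {(a, s), (b, p)})" for s
  have f: "joint_eigen {(a, s), (b, f s)}" if "s \<in> spectrum a" for s
    unfolding f_def using spectrum_joint_eigen[OF that na nb ba baa] by (rule someI_ex)
  have lip: "cmod (p - q) \<le> M * cmod (s - t)"
    if "joint_eigen {(a, s), (b, p)}" "joint_eigen {(a, t), (b, q)}" for s p t q
    by (rule joint_eigen_lipschitz[OF assms(1) _ that]) (rule assms(2))
  have flip: "M-lipschitz_on (spectrum a) f"
    by (rule lipschitz_onI) (use lip[OF f f] assms(1) in \<open>auto simp: dist_norm\<close>)
  then obtain x where x: "calc_rel a (spectrum a) f x"
    using calc_rel_exists[OF spectral_bound_normal[OF na]] lipschitz_on_continuous_on by blast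
  let ?d = "b - x"
  let ?c = "adj ?d * ?d"
  \<comment> \<open>The norm of \<open>?c\<close> is the modulus of a peak \<open>l\<close>. At a
    joint approximate eigenvalue \<open>(l, s, p)\<close> the element \<open>?d\<close> takes the
    value \<open>p - f s\<close>, and \<open>lip\<close> makes this 0.\<close>
  have "?c = 0"
  proof -
    have sa: "selfadjoint ?c" by (simp add: selfadjoint_def adj_mult adj_adj)
    obtain l where l: "cmod l = norm ?c" "spectral_peak ?c l" using spectral_peak_norm[OF sa] by blast
    have comm: "w * ?c = ?c * w" if "w * a = a * w" "w * adj a = adj a * w"
      "w * b = b * w" "w * adj b = adj b * w" for w
    proof -
      have "w * x = x * w" by (rule calc_rel_commute[OF x that(1,2)])
      then have d: "w * ?d = ?d * w" using that by (simp add: algebra_simps)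
      \<comment> \<open>Commutation of \<open>w\<close> with \<open>adj x\<close> is the adjoint of
        commutation of \<open>adj w\<close> with \<open>x\<close>, to which
        \<open>calc_rel_commute\<close> applies.\<close>
      have "a * adj w = adj w * a" "adj a * adj w = adj w * adj a"
        using arg_cong[OF that(2), of adj] arg_cong[OF that(1), of adj] by (simp_all add: adj_simps)
      then have "adj w * x = x * adj w"
        by (intro calc_rel_commute[OF x]) simp_all
      from arg_cong[OF this, of adj] have "w * adj x = adj x * w"
        by (simp add: adj_simps)
      then have "w * adj ?d = adj ?d * w" using that by (simp add: adj_simps algebra_simps)
      then have "w * ?c = adj ?d * (w * ?d)" by (simp flip: mult.assoc)
      then show ?thesis by (simp only: d mult.assoc)
    qed
    have cs: "a * ?c = ?c * a" "adj a * ?c = ?c * adj a" "b * ?c = ?c * b" "adj b * ?c = ?c * adj b"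
      by (rule comm; simp add: aa ab aab ba baa \<open>b * adj b = adj b * b\<close>)+
    obtain s p where sp: "joint_eigen {(?c, l), (a, s), (b, p)}"
      using joint_eigen_exists[OF l(2) na nb cs ba baa] by blast
    from joint_eigen_seq[OF this] obtain v where
      v: "eigen_seq v ?c l" "eigen_seq v a s" "eigen_seq v (adj a) (cnj s)"
        "eigen_seq v b p" "eigen_seq v (adj b) (cnj p)" by auto
    have s: "s \<in> spectrum a" by (rule eigen_seq_spectrum[OF v(2)])
    have "joint_eigen {(a, s), (b, p)}" by (rule joint_eigen_subset[OF sp]) auto
    \<comment> \<open>Both pairs lie over the same \<open>s\<close>, so the Lipschitz bound is
      0.\<close>
    from lip[OF this f[OF s]] have p: "p = f s" by simp
    have xs: "eigen_seq v x p" unfolding p by (rule eigen_seq_calc[OF x s v(2,3)])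
    have "eigen_seq v (- x) (- p)"
      using eigen_seq_mult[OF _ xs, of "- 1" "- 1"] v(1)
      by (simp add: eigen_seq_def scaleC_minus_left)
    then have "eigen_seq v ?d 0" using eigen_seq_add[OF v(4)] by fastforce
    \<comment> \<open>\<open>?d * v n\<close> tends to 0, hence so does \<open>?c * v n\<close>;
      both \<open>l\<close> and 0 are eigenvalues of \<open>?c\<close> along
      \<open>v\<close>.\<close>
    then have "l = 0"
      using eigen_seq_unique[OF v(1)]
      by (simp add: eigen_seq_def mult.assoc tendsto_mult_right_zero)
    then show ?thesis using l(1) by simp
  qed
  then have "b = x" using cstar_identity[of ?d] by simp
  with cont_fun_calculus_eq[OF na x] flip show ?thesis by blast
qed

end
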